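(* Let $k\ge1$, $\mathbf{a}_1,\dots,\mathbf{a}_k\in\mathbb{S}^{n-1}$, $\mathbf{b}\in\mathbb{S}^{k-1}$, let $\sigma(z)=\max(0,z)$ be the ReLU, and let $\sigma':\mathbb{R}\to[0,1]$ be a known $L$-Lipschitz non-decreasing function. Define $\mathcal{N}_2(\mathbf{x})=\sigma'\big(\sum_{i=1}^k \mathbf{b}_i\,\sigma(\mathbf{a}_i\cdot\mathbf{x})\big)$. Let $\mathcal{D}$ be any distribution on $\mathbb{S}^{n-1}\times[0,1]$ with $\mathbb{E}[y\mid\mathbf{x}]=\mathcal{N}_2(\mathbf{x})$, and let $(\mathbf{x}_i,y_i)_{i=1}^m$ be drawn i.i.d. from $\mathcal{D}$. There exists an algorithm that outputs a hypothesis $h$ such that with probability $1-\delta$, \[\mathbb{E}_{(\mathbf{x},y)\sim\mathcal{D}}\left[(h(\mathbf{x})-\mathcal{N}_2(\mathbf{x}))^2\right]\le\epsilon\] for $m=2^{O(kL/\epsilon)}\cdot\log(1/\delta)$. The algorithm runs in time polynomial in $m$ and $n$.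
   Context: $\mathbb{S}^{n-1}$ denotes the unit sphere in $\mathbb{R}^n$; the weights $\mathbf{a}_i,\mathbf{b}$ are unknown. *)

theory Defs
  imports "HOL-Probability.Probability"
begin

section \<open>A real random access machine with an activation oracle\<close>

text \<open>
  Since the data are real vectors, running time is measured on a real RAM: exact real arithmetic,
  comparison and memory access at unit cost. A state consists of natural-number registers, which
  serve as loop counters and addresses, and of countably many arrays of real cells. Natural numbers
  can be converted to reals, but not conversely, and programs contain no real constants. The known
  outer activation is available to a program only through evaluation at a point (\<open>Act\<close>).
  Subtraction of naturals truncates at 0, and division of reals by 0 yields 0.
\<close>

datatype iexp = ICon nat | IReg nat | IAdd iexp iexp | ISub iexp iexp | IMul iexp iexp

datatype rexp =
    OfNat iexp
  | Cell nat iexp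
  | RAdd rexp rexp | RSub rexp rexp | RMul rexp rexp | RDiv rexp rexp
  | Act rexp

datatype bexp = ILess iexp iexp | RLess rexp rexp | Neg bexp | Conj bexp bexp

datatype com =
    Skip
  | SetReg nat iexp
  | Store nat iexp rexp
  | Seq com com
  | Cond bexp com com
  | While bexp com

type_synonym state = "(nat \<Rightarrow> nat) \<times> (nat \<Rightarrow> nat \<Rightarrow> real)"

fun ival :: "state \<Rightarrow> iexp \<Rightarrow> nat" where
  "ival s (ICon c) = c"
| "ival s (IReg r) = fst s r"
| "ival s (IAdd e f) = ival s e + ival s f"
| "ival s (ISub e f) = ival s e - ival s f"
| "ival s (IMul e f) = ival s e * ival s f"

fun rval :: "(real \<Rightarrow> real) \<Rightarrow> state \<Rightarrow> rexp \<Rightarrow> real" where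
  "rval u s (OfNat e) = real (ival s e)"
| "rval u s (Cell A e) = snd s A (ival s e)"
| "rval u s (RAdd e f) = rval u s e + rval u s f"
| "rval u s (RSub e f) = rval u s e - rval u s f"
| "rval u s (RMul e f) = rval u s e * rval u s f"
| "rval u s (RDiv e f) = rval u s e / rval u s f"
| "rval u s (Act e) = u (rval u s e)"

fun bval :: "(real \<Rightarrow> real) \<Rightarrow> state \<Rightarrow> bexp \<Rightarrow> bool" where
  "bval u s (ILess e f) \<longleftrightarrow> ival s e < ival s f"
| "bval u s (RLess e f) \<longleftrightarrow> rval u s e < rval u s f"
| "bval u s (Neg b) \<longleftrightarrow> \<not> bval u s b"
| "bval u s (Conj b c) \<longleftrightarrow> bval u s b \<and> bval u s c"

fun icost :: "iexp \<Rightarrow> nat" where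
  "icost (ICon c) = 1"
| "icost (IReg r) = 1"
| "icost (IAdd e f) = icost e + icost f + 1"
| "icost (ISub e f) = icost e + icost f + 1"
| "icost (IMul e f) = icost e + icost f + 1"

fun rcost :: "rexp \<Rightarrow> nat" where
  "rcost (OfNat e) = icost e + 1"
| "rcost (Cell A e) = icost e + 1"
| "rcost (RAdd e f) = rcost e + rcost f + 1"
| "rcost (RSub e f) = rcost e + rcost f + 1"
| "rcost (RMul e f) = rcost e + rcost f + 1"
| "rcost (RDiv e f) = rcost e + rcost f + 1"
| "rcost (Act e) = rcost e + 1"

fun bcost :: "bexp \<Rightarrow> nat" where
  "bcost (ILess e f) = icost e + icost f + 1"
| "bcost (RLess e f) = rcost e + rcost f + 1"
| "bcost (Neg b) = bcost b + 1"
| "bcost (Conj b c) = bcost b + bcost c + 1"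

text \<open>\<open>exec u p s t s'\<close>: with oracle \<open>u\<close>, program \<open>p\<close> started in \<open>s\<close> halts in \<open>s'\<close> after \<open>t\<close> steps.\<close>

inductive exec :: "(real \<Rightarrow> real) \<Rightarrow> com \<Rightarrow> state \<Rightarrow> nat \<Rightarrow> state \<Rightarrow> bool" for u where
  Skip: "exec u Skip s 1 s"
| SetReg: "exec u (SetReg r e) s (icost e + 1) ((fst s)(r := ival s e), snd s)"
| Store: "exec u (Store A e f) s (icost e + rcost f + 1)
            (fst s, (snd s)(A := (snd s A)(ival s e := rval u s f)))"
| Seq: "exec u p s t s' \<Longrightarrow> exec u q s' t' s'' \<Longrightarrow> exec u (Seq p q) s (t + t') s''"
| CondTrue: "bval u s b \<Longrightarrow> exec u p s t s' \<Longrightarrow> exec u (Cond b p q) s (bcost b + t) s'"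
| CondFalse: "\<not> bval u s b \<Longrightarrow> exec u q s t s' \<Longrightarrow> exec u (Cond b p q) s (bcost b + t) s'"
| WhileFalse: "\<not> bval u s b \<Longrightarrow> exec u (While b p) s (bcost b) s"
| WhileTrue: "bval u s b \<Longrightarrow> exec u p s t s' \<Longrightarrow> exec u (While b p) s' t' s'' \<Longrightarrow>
            exec u (While b p) s (bcost b + t + t') s''"

lemma exec_deterministic:
  assumes "exec u p s t s'" and "exec u p s t2 s2"
  shows "t2 = t \<and> s2 = s'"
  using assms
proof (induction arbitrary: t2 s2 rule: exec.induct)
  case (Seq p s t s' q t' s'')
  from Seq.prems show ?case by cases (use Seq.IH in blast)
next
  case (CondTrue s b p t s' q)
  from CondTrue.prems show ?case by cases (use CondTrue in blast)+
next
  case (CondFalse s b q t s' p)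
  from CondFalse.prems show ?case by cases (use CondFalse in blast)+
next
  case (WhileFalse s b p)
  from WhileFalse.prems show ?case by cases (use WhileFalse in auto)
next
  case (WhileTrue s b p t s' t' s'')
  from WhileTrue.prems show ?case by cases (use WhileTrue in blast)+
qed (auto elim: exec.cases)


section \<open>Learning algorithms\<close>

text \<open>
  The dimension is an argument of the algorithm, so \<open>\<real>\<^sup>n\<close> is rendered as the
  extensional functions on \<open>{..<n}\<close>, with the product Borel algebra.
  A sample of size \<open>m\<close> is a function \<open>S\<close> on \<open>{..<m}\<close> with values \<open>S i = (x, y)\<close>.

  Input convention: registers 0, 1, 2 hold \<open>n\<close>, \<open>m\<close>, \<open>k\<close>; array 0 holds
  \<open>L\<close>, \<open>\<epsilon>\<close>, \<open>\<delta>\<close>; array 1 holds the sample points, with coordinate \<open>j\<close> of point \<open>i\<close>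
  in cell \<open>i * n + j\<close>; array 2 holds the labels. All other registers and cells are 0.
\<close>

definition input_state ::
    "nat \<Rightarrow> nat \<Rightarrow> nat \<Rightarrow> real \<Rightarrow> real \<Rightarrow> real \<Rightarrow> (nat \<Rightarrow> (nat \<Rightarrow> real) \<times> real) \<Rightarrow> state" where
  "input_state n m k L \<epsilon> \<delta> S =
     ((\<lambda>_. 0)(0 := n, 1 := m, 2 := k),
      (\<lambda>_ _. 0)
        (0 := (\<lambda>_. 0)(0 := L, 1 := \<epsilon>, 2 := \<delta>),
         1 := (\<lambda>p. if p < m * n then fst (S (p div n)) (p mod n) else 0),
         2 := (\<lambda>i. if i < m then snd (S i) else 0)))"

text \<open>A query point is written to array 3; the answer is read off from cell 0 of array 4.\<close>

definition query_state :: "nat \<Rightarrow> (nat \<Rightarrow> real) \<Rightarrow> state \<Rightarrow> state" where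
  "query_state n x s = (fst s, (snd s)(3 := (\<lambda>j. if j < n then x j else 0)))"

definition answer :: "state \<Rightarrow> real" where
  "answer s = snd s 4 0"

definition unit_sphere :: "nat \<Rightarrow> (nat \<Rightarrow> real) set" where
  "unit_sphere n = {x \<in> extensional {..<n}. L2_set x {..<n} = 1}"

text \<open>
  An algorithm is a pair of programs. The hypothesis it outputs is the memory content in which
  \<open>learner\<close> halts, and that content denotes the function computed from it by \<open>evaluator\<close>;
  hence a hypothesis always has a finite description and can be evaluated on new points.
  Both programs have to respect the time bound \<open>T\<close>. By determinism, \<open>h\<close> is uniquely
  determined on the sphere.
\<close>

definition outputs_hypothesis ::
    "(real \<Rightarrow> real) \<Rightarrow> com \<Rightarrow> com \<Rightarrow> nat \<Rightarrow> nat \<Rightarrow> state \<Rightarrow> ((nat \<Rightarrow> real) \<Rightarrow> real) \<Rightarrow> bool" where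
  "outputs_hypothesis u learner evaluator n T s0 h \<longleftrightarrow>
     (\<exists>t s. exec u learner s0 t s \<and> t \<le> T \<and>
        (\<forall>x\<in>unit_sphere n. \<exists>t' s'.
           exec u evaluator (query_state n x s) t' s' \<and> t' \<le> T \<and> answer s' = h x))"


section \<open>Networks and data distributions\<close>

definition relu :: "real \<Rightarrow> real" where
  "relu z = max 0 z"

definition network2 ::
    "nat \<Rightarrow> nat \<Rightarrow> (real \<Rightarrow> real) \<Rightarrow> (nat \<Rightarrow> nat \<Rightarrow> real) \<Rightarrow> (nat \<Rightarrow> real) \<Rightarrow> (nat \<Rightarrow> real) \<Rightarrow> real" where
  "network2 n k u a b x = u (\<Sum>i<k. b i * relu (\<Sum>j<n. a i j * x j))"

abbreviation borel_vec :: "nat \<Rightarrow> (nat \<Rightarrow> real) measure" where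
  "borel_vec n \<equiv> Pi\<^sub>M {..<n} (\<lambda>_. borel)"

definition distribution_on_sphere :: "nat \<Rightarrow> ((nat \<Rightarrow> real) \<times> real) measure \<Rightarrow> bool" where
  "distribution_on_sphere n D \<longleftrightarrow> prob_space D \<and>
     sets D = sets (restrict_space (borel_vec n \<Otimes>\<^sub>M borel) (unit_sphere n \<times> {0..1}))"

definition label_given_point ::
    "nat \<Rightarrow> ((nat \<Rightarrow> real) \<times> real) measure \<Rightarrow> (nat \<Rightarrow> real) \<times> real \<Rightarrow> real" where
  "label_given_point n D = real_cond_exp D (vimage_algebra (space D) fst (borel_vec n)) snd"

end

theory Submission imports Defs begin

text \<open>
  The learner is a single pass of kernelised stochastic gradient descent (Alphatron) for the kernel
  \<open>1 / (1 - x \<cdot> x' / 2)\<close>, whose coefficient in every degree \<open>j\<close> is \<open>2 ^ (-j)\<close>; the hypothesis averages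
  the predictions of all iterates. ReLU is uniformly within \<open>1/R\<close> of an entire function whose
  Taylor coefficients are at most \<open>R ^ j / j!\<close>, so the inner layer is within \<open>k/R\<close> of a function \<open>v\<close>
  whose squared norm \<open>V\<close> in the reproducing kernel Hilbert space is at most \<open>k\<^sup>2 exp (4 R)\<close>. Since the
  outer activation is monotone and Lipschitz, each update decreases the expected squared distance
  of the iterate to \<open>v\<close> by a multiple of the current error. The exponential moments of this
  distance form a supermartingale, which bounds the average error with probability \<open>1 - \<delta>\<close> for a
  number of samples that is linear in \<open>log (1/\<delta>)\<close>. With \<open>R = 8 k L / \<epsilon>\<close> this yields the claim if
  \<open>\<epsilon> < k L\<close>; otherwise the constant hypothesis \<open>\<sigma>' 0\<close> suffices, which is the learner with rate 0.
\<close>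

section \<open>Approximation of ReLU by entire functions\<close>

text \<open>No Hilbert space is built. All that is used of the norm of \<open>v\<close> is that
  certain finite quadratic forms are nonnegative; hence the potential is nonnegative and controls
  the pointwise error. \<open>v\<close>, \<open>R\<close> and \<open>V\<close> belong to the
  analysis only, and the kernel is a rational function, which exact arithmetic can evaluate. The
  weights \<open>2 ^ (-j)\<close> are summable, so that evaluation on the sphere is bounded, yet
  large enough compared with the squared Taylor coefficients of the entire function for
  \<open>V\<close> to be finite. The obstacle is confidence at the price of a single factor
  \<open>log (1/\<delta>)\<close>. The increments of the potential have no bound known beforehand:
  their size is governed by the square root of the potential itself. Hoeffding's lemma, applied
  conditionally on the past, turns this into a term proportional to the potential, which is absorbed
  into the exponent. A step size inversely proportional to \<open>log (1/\<delta>)\<close> then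
  keeps the deviation below a fraction of \<open>\<epsilon>\<close>.\<close>

lemma sums_sinc: "(\<lambda>j. sin_coeff (Suc j) * x ^ j) sums sinc x"
proof (cases "x = 0")
  case True
  have "(\<lambda>j. sin_coeff (Suc j) * (0::real) ^ j) sums sin_coeff (Suc 0)"
    using powser_sums_zero[of "\<lambda>j. sin_coeff (Suc j)"] by simp
  with True show ?thesis by (simp add: sin_coeff_def)
next
  case False
  have "(\<lambda>j. sin_coeff j * x ^ j) sums sin x"
    using sin_converges[of x] by simp
  then have "(\<lambda>j. sin_coeff (Suc j) * x ^ Suc j) sums sin x"
    by (subst sums_Suc_iff) simp
  then have "(\<lambda>j. sin_coeff (Suc j) * x ^ Suc j / x) sums (sin x / x)"
    by (rule sums_divide)
  with False show ?thesis by simp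
qed

lemma Si_0: "Si 0 = 0"
  using Si_neg[of 0] by simp

text \<open>Both sides have derivative \<open>sinc\<close> and vanish at 0. The coefficient for
  \<open>j = 0\<close> is \<open>0 / 0\<close>, which is 0.\<close>

lemma sums_Si: "(\<lambda>j. sin_coeff j / real j * x ^ j) sums Si x"
proof -
  define c :: "nat \<Rightarrow> real" where "c = (\<lambda>j. sin_coeff j / real j)"
  have summ: "summable (\<lambda>j. c j * y ^ j)" for y :: real
  proof (rule summable_comparison_test')
    show "summable (\<lambda>j. inverse (fact j) * \<bar>y\<bar> ^ j)"
      by (rule summable_exp)
    fix j :: nat
    have "\<bar>c j\<bar> \<le> inverse (fact j)"
      by (cases "j = 0") (auto simp: c_def sin_coeff_def abs_mult field_simps)
    then show "norm (c j * y ^ j) \<le> inverse (fact j) * \<bar>y\<bar> ^ j"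
      by (simp add: abs_mult power_abs mult_right_mono)
  qed
  define F where "F = (\<lambda>y. \<Sum>j. c j * y ^ j)"
  have "diffs c = (\<lambda>j. sin_coeff (Suc j))"
    by (auto simp: diffs_def c_def fun_eq_iff simp del: of_nat_Suc)
  then have "(F has_real_derivative sinc y) (at y)" for y
    using termdiffs_strong_converges_everywhere[of c y, OF summ] sums_unique[OF sums_sinc[of y]]
    by (simp add: F_def)
  then have "((\<lambda>y. F y - Si y) has_real_derivative 0) (at y)" for y
    using DERIV_diff[OF _ DERIV_Si] by fastforce
  then have "F x - Si x = F 0 - Si 0"
    using DERIV_isconst_all by blast
  also have "\<dots> = 0"
    using powser_zero[of c] by (simp add: F_def Si_0 c_def sin_coeff_def)
  finally show ?thesis
    using summable_sums[OF summ[of x]] by (simp add: F_def c_def)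
qed

text \<open>Partial integration replaces the slowly decaying tail \<open>Si x - \<pi>/2\<close> by one that is \<open>O(1/x)\<close>
  after multiplication with \<open>x\<close>.\<close>

lemma Si_tail:
  assumes "x > 0"
  shows "\<bar>x * (Si x - pi / 2) + cos x\<bar> \<le> 1"
proof -
  \<comment> \<open>The summand \<open>cos y / y\<close> cancels the derivative
    \<open>sin y / y\<close> of \<open>Si\<close> and leaves \<open>- cos y / y\<^sup>2\<close>,
    which lies between the derivatives of \<open>1 / y\<close> and \<open>- 1 / y\<close>. So
    \<open>E y + 1 / y\<close> decreases and \<open>E y - 1 / y\<close> increases, both towards
    \<open>pi / 2\<close>.\<close>
  define E where "E = (\<lambda>y. Si y + cos y / y)"
  have E': "(E has_real_derivative - cos y / y\<^sup>2) (at y)" if "y > 0" for y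
    unfolding E_def using that
    by (auto intro!: derivative_eq_intros DERIV_Si simp: field_simps power2_eq_square)
  have inv': "((\<lambda>y. 1 / y) has_real_derivative - 1 / y\<^sup>2) (at y)" if "y > 0" for y :: real
    using that by (auto intro!: derivative_eq_intros simp: field_simps power2_eq_square)
  have up: "E x + 1 / x \<ge> E y + 1 / y" if "x \<le> y" for y
  proof (rule DERIV_nonpos_imp_nonincreasing[OF that])
    fix t assume "x \<le> t" "t \<le> y"
    then have "t > 0" using assms by simp
    moreover have "- cos t / t\<^sup>2 + - 1 / t\<^sup>2 \<le> 0"
      using cos_ge_minus_one[of t] by (simp add: divide_simps)
    ultimately show "\<exists>D. ((\<lambda>y. E y + 1 / y) has_real_derivative D) (at t) \<and> D \<le> 0"
      using DERIV_add[OF E' inv'] by blast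
  qed
  have lo: "E x - 1 / x \<le> E y - 1 / y" if "x \<le> y" for y
  proof (rule DERIV_nonneg_imp_nondecreasing[OF that])
    fix t assume "x \<le> t" "t \<le> y"
    then have "t > 0" using assms by simp
    moreover have "- cos t / t\<^sup>2 - (- 1 / t\<^sup>2) \<ge> 0"
      using cos_le_one[of t] by (simp add: divide_simps)
    ultimately show "\<exists>D. ((\<lambda>y. E y - 1 / y) has_real_derivative D) (at t) \<and> 0 \<le> D"
      using DERIV_diff[OF E' inv'] by blast
  qed
  have inv0: "((\<lambda>y::real. 1 / y) \<longlongrightarrow> 0) at_top"
    by (intro tendsto_divide_0[OF tendsto_const] filterlim_at_top_imp_at_infinity filterlim_ident)
  have "((\<lambda>y::real. cos y / y) \<longlongrightarrow> 0) at_top"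
  proof (rule Lim_null_comparison[OF _ inv0])
    show "\<forall>\<^sub>F y::real in at_top. norm (cos y / y) \<le> 1 / y"
      using eventually_gt_at_top[of 0] by eventually_elim (simp add: divide_right_mono)
  qed
  then have E: "(E \<longlongrightarrow> pi / 2) at_top"
    unfolding E_def using tendsto_add[OF Si_at_top] by fastforce
  have ev: "\<forall>\<^sub>F y in at_top. x \<le> y" by (rule eventually_ge_at_top)
  have "E x + 1 / x \<ge> pi / 2 + 0"
    by (rule tendsto_upperbound[OF tendsto_add[OF E inv0]]) (use eventually_mono[OF ev up] in auto)
  moreover have "E x - 1 / x \<le> pi / 2 - 0"
    by (rule tendsto_lowerbound[OF tendsto_diff[OF E inv0]]) (use eventually_mono[OF ev lo] in auto)
  ultimately have "\<bar>E x - pi / 2\<bar> \<le> 1 / x" by linarith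
  then have "x * \<bar>E x - pi / 2\<bar> \<le> 1"
    using assms by (simp add: field_simps)
  moreover have "x * \<bar>E x - pi / 2\<bar> = \<bar>x * (E x - pi / 2)\<bar>"
    using assms by (simp add: abs_mult)
  moreover have "x * (E x - pi / 2) = x * (Si x - pi / 2) + cos x"
    using assms by (simp add: E_def field_simps)
  ultimately show ?thesis by simp
qed

text \<open>For positive \<open>x\<close> this is \<open>Si_tail\<close> plus the constant 1; the
  expression is even in \<open>x\<close>.\<close>

lemma abs_approx: "\<bar>x * Si x + cos x - 1 - pi / 2 * \<bar>x\<bar>\<bar> \<le> 2"
proof -
  have pos: "\<bar>x * Si x + cos x - 1 - pi / 2 * x\<bar> \<le> 2" if "x > 0" for x
    using Si_tail[OF that] by (auto simp: algebra_simps)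
  show ?thesis
  proof (cases x "0::real" rule: linorder_cases)
    case less
    then show ?thesis using pos[of "-x"] Si_neg[of "-x"] by simp
  next
    case equal
    then show ?thesis by simp
  next
    case greater
    then show ?thesis using pos[of x] by simp
  qed
qed

text \<open>Truncating \<open>\<bar>z\<bar> = 2/\<pi> \<integral>\<^sub>0\<^sup>\<infinity> (1 - cos (t z)) / t\<^sup>2 dt\<close> at \<open>t = R\<close> gives an entire function of
  exponential type \<open>R\<close> within \<open>O(1/R)\<close> of \<open>\<bar>z\<bar>\<close>; partial integration expresses it through \<open>Si (R z)\<close>.\<close>

lemma relu_approx:
  fixes R :: real
  assumes R: "R \<ge> 1"
  obtains p :: "nat \<Rightarrow> real" and f :: "real \<Rightarrow> real"
  where "\<And>z. (\<lambda>j. p j * z ^ j) sums f z" and "\<And>j. \<bar>p j\<bar> \<le> R ^ j / fact j"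
    and "\<And>z. \<bar>f z - relu z\<bar> \<le> 1 / R"
proof
  define s :: "nat \<Rightarrow> real" where "s = (\<lambda>j. sin_coeff j / real j)"
  define f where "f = (\<lambda>z. (R * z * Si (R * z) + cos (R * z) - 1) / (pi * R) + z / 2)"
  define p where "p = (\<lambda>j. case j of 0 \<Rightarrow> 0
     | Suc i \<Rightarrow> R ^ i * (s i + cos_coeff j) / pi + (if i = 0 then 1 / 2 else 0))"
  show "(\<lambda>j. p j * z ^ j) sums f z" for z
  proof -
    have "(\<lambda>j. s j * (R * z) ^ j) sums Si (R * z)"
      using sums_Si by (simp add: s_def)
    from sums_mult[OF this, of "R * z"]
    have 1: "(\<lambda>j. s j * (R * z) ^ Suc j) sums (R * z * Si (R * z))"
      by (simp add: ac_simps)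
    have "(\<lambda>j. cos_coeff j * (R * z) ^ j) sums cos (R * z)"
      using cos_converges[of "R * z"] by simp
    then have "(\<lambda>j. cos_coeff (Suc j) * (R * z) ^ Suc j) sums (cos (R * z) - 1)"
      by (subst sums_Suc_iff) simp
    from sums_divide[OF sums_add[OF 1 this], of "pi * R"]
    have "(\<lambda>j. (s j + cos_coeff (Suc j)) * (R * z) ^ Suc j / (pi * R)) sums
        ((R * z * Si (R * z) + cos (R * z) - 1) / (pi * R))"
      by (simp add: algebra_simps)
    moreover have "(\<lambda>j. if j = 0 then z / 2 else 0) sums (z / 2)"
      using sums_single[of 0 "\<lambda>_. z / 2"] by simp
    ultimately have "(\<lambda>j. (s j + cos_coeff (Suc j)) * (R * z) ^ Suc j / (pi * R)
        + (if j = 0 then z / 2 else 0)) sums f z"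
      unfolding f_def by (rule sums_add)
    moreover have "(s j + cos_coeff (Suc j)) * (R * z) ^ Suc j / (pi * R)
        + (if j = 0 then z / 2 else 0) = p (Suc j) * z ^ Suc j" for j
      using R by (simp add: p_def power_mult_distrib field_simps)
    ultimately have "(\<lambda>j. p (Suc j) * z ^ Suc j) sums f z"
      by simp
    then show ?thesis
      by (subst (asm) sums_Suc_iff) (simp add: p_def)
  qed
  show "\<bar>p j\<bar> \<le> R ^ j / fact j" for j
  proof (cases j)
    case (Suc i)
    show ?thesis
    proof (cases "i = 0")
      case True
      then show ?thesis
        using R Suc by (simp add: p_def s_def cos_coeff_def)
    next
      case False
      \<comment> \<open>The two series contribute \<open>2 / fact j\<close> and
        \<open>1 / fact j\<close>; the resulting 3 is absorbed by the division by
        \<open>pi\<close>.\<close>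
      have "\<bar>s i\<bar> \<le> 1 / (fact i * real i)"
        by (auto simp: s_def sin_coeff_def abs_mult)
      also have "\<dots> \<le> 2 / (fact i * real (Suc i))"
      proof -
        have "real (Suc i) * 1 \<le> 2 * real i" using False by simp
        then have "fact i * (real (Suc i)) \<le> 2 * (fact i * real i)"
          by (simp only: mult.left_commute[of 2] mult_left_mono mult_1_right) simp
        then show ?thesis using False by (simp add: divide_simps)
      qed
      finally have "\<bar>s i\<bar> \<le> 2 / fact j" by (simp add: Suc mult.commute)
      moreover have "\<bar>cos_coeff j\<bar> \<le> 1 / (fact j :: real)"
        by (auto simp: cos_coeff_def abs_mult)
      ultimately have "\<bar>s i + cos_coeff j\<bar> \<le> 3 / fact j"
        by (simp add: add_divide_distrib[symmetric])
      then have "R ^ i * \<bar>s i + cos_coeff j\<bar> / pi \<le> R ^ i * (3 / fact j) / pi"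
        using R by (intro divide_right_mono mult_left_mono) auto
      moreover have "\<bar>p j\<bar> = R ^ i * \<bar>s i + cos_coeff j\<bar> / pi"
        using R False Suc by (simp add: p_def abs_mult)
      ultimately have "\<bar>p j\<bar> \<le> R ^ i * (3 / fact j) / pi" by simp
      also have "\<dots> \<le> R ^ i * 1 / fact j"
        using R pi_gt3 by (simp add: divide_simps)
      also have "\<dots> \<le> R ^ j / fact j"
        using R Suc by (simp add: divide_right_mono)
      finally show ?thesis .
    qed
  qed (simp add: p_def)
  show "\<bar>f z - relu z\<bar> \<le> 1 / R" for z
  proof -
    have "relu z = z / 2 + \<bar>z\<bar> / 2" by (auto simp: relu_def)
    then have "f z - relu z = (R * z * Si (R * z) + cos (R * z) - 1 - pi / 2 * \<bar>R * z\<bar>) / (pi * R)"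
      using R by (simp add: f_def field_simps abs_mult)
    also have "\<bar>\<dots>\<bar> = \<bar>R * z * Si (R * z) + cos (R * z) - 1 - pi / 2 * \<bar>R * z\<bar>\<bar> / (pi * R)"
      using R by (simp add: abs_mult)
    also have "\<dots> \<le> 2 / (pi * R)"
      using abs_approx[of "R * z"] R by (intro divide_right_mono) auto
    also have "\<dots> \<le> 1 / R"
      using R pi_gt3 by (simp add: divide_simps)
    finally show ?thesis .
  qed
qed

section \<open>The kernel\<close>

definition ip :: "nat \<Rightarrow> (nat \<Rightarrow> real) \<Rightarrow> (nat \<Rightarrow> real) \<Rightarrow> real" where
  "ip n x y = (\<Sum>j<n. x j * y j)"

lemma ip_commute: "ip n x y = ip n y x"
  by (simp add: ip_def mult.commute)

lemma ip_self: "x \<in> unit_sphere n \<Longrightarrow> ip n x x = 1"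
  by (auto simp: ip_def unit_sphere_def L2_set_def power2_eq_square)

lemma abs_ip_le_1:
  assumes "x \<in> unit_sphere n" "y \<in> unit_sphere n"
  shows "\<bar>ip n x y\<bar> \<le> 1"
proof -
  have "\<bar>ip n x y\<bar> \<le> (\<Sum>j<n. \<bar>x j\<bar> * \<bar>y j\<bar>)"
    unfolding ip_def abs_mult[symmetric] by (rule sum_abs)
  also have "\<dots> \<le> L2_set x {..<n} * L2_set y {..<n}"
    by (rule L2_set_mult_ineq)
  finally show ?thesis
    using assms by (simp add: unit_sphere_def)
qed

lemma abs_le_1_on_sphere: "b \<in> unit_sphere k \<Longrightarrow> i < k \<Longrightarrow> \<bar>b i\<bar> \<le> 1"
  using member_le_sum[of i "{..<k}" "\<lambda>i. (b i)\<^sup>2"]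
  by (auto simp: unit_sphere_def L2_set_def abs_square_le_1)

text \<open>One factor \<open>ip n (z u) (z v)\<close> is a sum over coordinates \<open>l\<close> of
  \<open>z u l * z v l\<close>. Moving these into the coefficients leaves a sum over
  \<open>l\<close> of forms of degree \<open>j\<close> with coefficients \<open>c u * z u l\<close>,
  whence the induction over arbitrary \<open>c\<close>. This is the Schur product theorem for powers
  of a Gram matrix.\<close>

lemma gram_power_psd:
  "0 \<le> (\<Sum>u\<in>U. \<Sum>v\<in>U. c u * c v * ip n (z u) (z v) ^ j)"
proof (induction j arbitrary: c)
  case 0
  have "(\<Sum>u\<in>U. \<Sum>v\<in>U. c u * c v) = (\<Sum>u\<in>U. c u)\<^sup>2"
    by (simp add: power2_eq_square sum_product)
  then show ?case by simp
next
  case (Suc j)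
  have "(\<Sum>u\<in>U. \<Sum>v\<in>U. c u * c v * ip n (z u) (z v) ^ Suc j)
      = (\<Sum>u\<in>U. \<Sum>v\<in>U. \<Sum>l<n. (c u * z u l) * (c v * z v l) * ip n (z u) (z v) ^ j)"
  proof (intro sum.cong refl)
    fix u v
    have "c u * c v * ip n (z u) (z v) ^ Suc j
        = (\<Sum>l<n. z u l * z v l) * (c u * c v * ip n (z u) (z v) ^ j)"
      by (simp add: ip_def[of n "z u" "z v"] ac_simps)
    also have "\<dots> = (\<Sum>l<n. (c u * z u l) * (c v * z v l) * ip n (z u) (z v) ^ j)"
      unfolding sum_distrib_right by (intro sum.cong refl) (simp only: mult_ac)
    finally show "c u * c v * ip n (z u) (z v) ^ Suc j
        = (\<Sum>l<n. (c u * z u l) * (c v * z v l) * ip n (z u) (z v) ^ j)" .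
  qed
  also have "\<dots> = (\<Sum>u\<in>U. \<Sum>l<n. \<Sum>v\<in>U. (c u * z u l) * (c v * z v l) * ip n (z u) (z v) ^ j)"
    by (intro sum.cong refl sum.swap)
  also have "\<dots> = (\<Sum>l<n. \<Sum>u\<in>U. \<Sum>v\<in>U. (c u * z u l) * (c v * z v l) * ip n (z u) (z v) ^ j)"
    by (rule sum.swap)
  also have "\<dots> \<ge> 0"
    by (intro sum_nonneg Suc.IH)
  finally show ?case .
qed

text \<open>Cleared of the inner fraction, so that it can be computed from natural constants. Its
  value 2 at \<open>s = 1\<close> is the squared norm of an evaluation on the sphere.\<close>

definition kernel :: "real \<Rightarrow> real" where
  "kernel s = 2 / (2 - s)"

lemma kernel_sums:
  assumes "\<bar>s\<bar> \<le> 1"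
  shows "(\<lambda>j. (s / 2) ^ j) sums kernel s"
proof -
  have "kernel s = 1 / (1 - s / 2)"
    using assms by (simp add: kernel_def divide_simps)
  then show ?thesis
    using geometric_sums[of "s / 2"] assms by simp
qed

text \<open>\<open>rkhs_bound n v V\<close> says that, in the reproducing kernel Hilbert space of the kernel, \<open>v\<close> has
  squared norm at most \<open>V\<close>: the form below is the squared distance between \<open>v\<close> and
  \<open>\<Sum>s<t. \<alpha> s * kernel (ip n (x s) \<cdot>)\<close>, with the squared norm of \<open>v\<close> replaced by \<open>V\<close>.\<close>

definition rkhs_bound :: "nat \<Rightarrow> ((nat \<Rightarrow> real) \<Rightarrow> real) \<Rightarrow> real \<Rightarrow> bool" where
  "rkhs_bound n v V \<longleftrightarrow> (\<forall>(t::nat) \<alpha> x. (\<forall>s<t. x s \<in> unit_sphere n) \<longrightarrow>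
     0 \<le> (\<Sum>s<t. \<Sum>r<t. \<alpha> s * \<alpha> r * kernel (ip n (x s) (x r))) - 2 * (\<Sum>s<t. \<alpha> s * v (x s)) + V)"

text \<open>Degree \<open>j\<close> part of the squared distance, as a Gram form of the points \<open>x s / \<surd>2\<close> and \<open>\<surd>2 a i\<close>.\<close>

lemma homogeneous_part_nonneg:
  fixes t k j :: nat and q :: real
  shows "0 \<le> (\<Sum>s<t. \<Sum>r<t. \<alpha> s * \<alpha> r * (ip n (x s) (x r) / 2) ^ j)
     - 2 * (\<Sum>s<t. \<alpha> s * (\<Sum>i<k. b i * (q * ip n (a i) (x s) ^ j)))
     + q\<^sup>2 * 2 ^ j * (\<Sum>i<k. \<Sum>i'<k. b i * b i' * ip n (a i) (a i') ^ j)"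
proof -
  define U where "U = {..<t} <+> {..<k}"
  define c where "c = case_sum \<alpha> (\<lambda>i. - (q * b i))"
  \<comment> \<open>The scalings cancel in the mixed products, produce the \<open>1 / 2\<close> of
    the kernel among the points \<open>x s\<close>, and shift the reciprocal weight
    \<open>2 ^ j\<close> to the Gram form of the \<open>a i\<close>.\<close>
  define z where "z = case_sum (\<lambda>s l. x s l / sqrt 2) (\<lambda>i l. sqrt 2 * a i l)"
  have xx: "ip n (z (Inl s)) (z (Inl r)) = ip n (x s) (x r) / 2" for s r
    by (simp add: ip_def z_def sum_divide_distrib)
  have aa: "ip n (z (Inr i)) (z (Inr i')) = 2 * ip n (a i) (a i')" for i i'
  proof -
    have "sqrt 2 * p * (sqrt 2 * q) = 2 * (p * q)" for p q :: real
      by (simp only: mult.assoc mult.left_commute[of p] real_sqrt_mult_self)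
         (simp flip: mult.assoc)
    then show ?thesis
      unfolding ip_def z_def sum_distrib_left by (simp only: sum.case)
  qed
  have xa: "ip n (z (Inl s)) (z (Inr i)) = ip n (a i) (x s)"
    "ip n (z (Inr i)) (z (Inl s)) = ip n (a i) (x s)" for s i
    by (simp_all add: ip_def z_def mult.commute)
  have U: "sum f U = (\<Sum>s<t. f (Inl s)) + (\<Sum>i<k. f (Inr i))" for f :: "nat + nat \<Rightarrow> real"
    unfolding U_def by (subst sum.Plus) auto
  have cc: "c (Inl s) * c (Inl r) * y = \<alpha> s * \<alpha> r * y"
    "c (Inl s) * c (Inr i) * y = - (\<alpha> s * (b i * (q * y)))"
    "c (Inr i) * c (Inl s) * y = - (\<alpha> s * (b i * (q * y)))"
    "c (Inr i) * c (Inr i') * (2 * y) ^ j = q\<^sup>2 * 2 ^ j * (b i * b i' * y ^ j)" for s r i i' y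
    by (simp_all add: c_def power2_eq_square power_mult_distrib)
  have "0 \<le> (\<Sum>u\<in>U. \<Sum>v\<in>U. c u * c v * ip n (z u) (z v) ^ j)"
    by (rule gram_power_psd)
  also have "\<dots> = (\<Sum>s<t. \<Sum>r<t. \<alpha> s * \<alpha> r * (ip n (x s) (x r) / 2) ^ j)
     + (\<Sum>s<t. \<Sum>i<k. - (\<alpha> s * (b i * (q * ip n (a i) (x s) ^ j))))
     + ((\<Sum>i<k. \<Sum>s<t. - (\<alpha> s * (b i * (q * ip n (a i) (x s) ^ j))))
     + (\<Sum>i<k. \<Sum>i'<k. q\<^sup>2 * 2 ^ j * (b i * b i' * ip n (a i) (a i') ^ j)))"
    by (simp only: U sum.distrib cc xx aa xa)
  also have "(\<Sum>i<k. \<Sum>s<t. - (\<alpha> s * (b i * (q * ip n (a i) (x s) ^ j))))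
     = (\<Sum>s<t. \<Sum>i<k. - (\<alpha> s * (b i * (q * ip n (a i) (x s) ^ j))))"
    by (rule sum.swap)
  finally show ?thesis
    unfolding sum_distrib_left[symmetric] sum_negf by linarith
qed

text \<open>Degree by degree: \<open>homogeneous_part_nonneg\<close> leaves the squared norm of the
  degree \<open>j\<close> part of the function, at most \<open>(p j)\<^sup>2 * 2 ^ j\<close> times
  \<open>k\<^sup>2\<close>, since every entry of the Gram form is at most 1. With
  \<open>q = (2 * R) ^ j / fact j\<close> this is at most \<open>k\<^sup>2 * q * q\<close>. One
  factor \<open>q\<close> is bounded by \<open>exp (2 * R)\<close>; the other one sums to
  \<open>exp (2 * R)\<close>.\<close>

lemma rkhs_bound_combination:
  fixes p :: "nat \<Rightarrow> real" and f :: "real \<Rightarrow> real" and R :: real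
  assumes f: "\<And>z. (\<lambda>j. p j * z ^ j) sums f z"
    and p: "\<And>j. \<bar>p j\<bar> \<le> R ^ j / fact j" and R: "R \<ge> 0"
    and a: "\<forall>i<k. a i \<in> unit_sphere n" and b: "\<And>i. i < k \<Longrightarrow> \<bar>b i\<bar> \<le> 1"
  shows "rkhs_bound n (\<lambda>x. \<Sum>i<k. b i * f (ip n (a i) x)) ((real k)\<^sup>2 * exp (4 * R))"
  unfolding rkhs_bound_def
proof (intro allI impI)
  fix t :: nat and \<alpha> :: "nat \<Rightarrow> real" and x :: "nat \<Rightarrow> nat \<Rightarrow> real"
  assume x: "\<forall>s<t. x s \<in> unit_sphere n"
  define T where "T = (\<lambda>j. (\<Sum>s<t. \<Sum>r<t. \<alpha> s * \<alpha> r * (ip n (x s) (x r) / 2) ^ j)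
     - 2 * (\<Sum>s<t. \<alpha> s * (\<Sum>i<k. b i * (p j * ip n (a i) (x s) ^ j)))
     + (real k)\<^sup>2 * (exp (2 * R) * ((2 * R) ^ j / fact j)))"
  have "(\<lambda>j. (2 * R) ^ j / fact j) sums exp (2 * R)"
    using exp_converges[of "2 * R"] by (simp add: divide_inverse mult.commute)
  from sums_mult[OF this, of "exp (2 * R)"]
  have "(\<lambda>j. exp (2 * R) * ((2 * R) ^ j / fact j)) sums exp (4 * R)"
    by (simp add: mult_exp_exp)
  then have "T sums ((\<Sum>s<t. \<Sum>r<t. \<alpha> s * \<alpha> r * kernel (ip n (x s) (x r)))
     - 2 * (\<Sum>s<t. \<alpha> s * (\<Sum>i<k. b i * f (ip n (a i) (x s)))) + (real k)\<^sup>2 * exp (4 * R))"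
    unfolding T_def
    by (intro sums_add sums_diff sums_mult sums_sum kernel_sums f abs_ip_le_1) (use x in auto)
  moreover have "0 \<le> T j" for j
  proof -
    define q where "q = (2 * R) ^ j / fact j"
    have "(\<lambda>j. (2 * R) ^ j / fact j) sums exp (2 * R)"
      using exp_converges[of "2 * R"] by (simp add: divide_inverse mult.commute)
    then have q_le: "q \<le> exp (2 * R)"
      using sum_le_suminf[of "\<lambda>j. (2 * R) ^ j / fact j" "{j}"] R
      by (simp add: q_def sums_iff)
    have q0: "0 \<le> q" using R by (simp add: q_def)
    \<comment> \<open>Enlarging \<open>2 ^ j\<close> to \<open>2 ^ j * 2 ^ j\<close> makes the
      right-hand side a perfect square.\<close>
    have p2: "(p j)\<^sup>2 * 2 ^ j \<le> q * q"
    proof -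
      have "\<bar>p j\<bar>\<^sup>2 * 2 ^ j \<le> (R ^ j / fact j)\<^sup>2 * (2 ^ j * 2 ^ j)"
        by (intro mult_mono power_mono p) auto
      also have "\<dots> = q * q"
        by (simp add: q_def power_mult_distrib power2_eq_square field_simps)
      finally show ?thesis by simp
    qed
    have G: "(\<Sum>i<k. \<Sum>i'<k. b i * b i' * ip n (a i) (a i') ^ j) \<le> (\<Sum>i<k. \<Sum>i'<k. 1)"
    proof (intro sum_mono)
      fix i i' assume i: "i \<in> {..<k}" "i' \<in> {..<k}"
      have "\<bar>b i * b i' * ip n (a i) (a i') ^ j\<bar> \<le> 1 * 1 * 1 ^ j"
        unfolding abs_mult power_abs
        by (intro mult_mono power_mono b abs_ip_le_1) (use i a in auto)
      then show "b i * b i' * ip n (a i) (a i') ^ j \<le> 1" by simp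
    qed
    have "(p j)\<^sup>2 * 2 ^ j * (\<Sum>i<k. \<Sum>i'<k. b i * b i' * ip n (a i) (a i') ^ j)
        \<le> (p j)\<^sup>2 * 2 ^ j * (real k)\<^sup>2"
      using G by (intro mult_left_mono) (auto simp: power2_eq_square)
    also have "\<dots> \<le> (exp (2 * R) * q) * (real k)\<^sup>2"
      using p2 mult_right_mono[OF q_le q0] by (intro mult_right_mono) auto
    finally have "(p j)\<^sup>2 * 2 ^ j * (\<Sum>i<k. \<Sum>i'<k. b i * b i' * ip n (a i) (a i') ^ j)
        \<le> (real k)\<^sup>2 * (exp (2 * R) * q)" by (simp add: mult.commute)
    then show ?thesis
      using homogeneous_part_nonneg[of \<alpha> n x j t b "p j" a k] unfolding T_def q_def by linarith
  qed
  ultimately show "0 \<le> (\<Sum>s<t. \<Sum>r<t. \<alpha> s * \<alpha> r * kernel (ip n (x s) (x r)))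
     - 2 * (\<Sum>s<t. \<alpha> s * (\<Sum>i<k. b i * f (ip n (a i) (x s)))) + (real k)\<^sup>2 * exp (4 * R)"
    using sums_le[OF _ sums_zero] by blast
qed

section \<open>The iterates and their distance to a comparison function\<close>

primrec score ::
    "nat \<Rightarrow> (real \<Rightarrow> real) \<Rightarrow> real \<Rightarrow> (nat \<Rightarrow> (nat \<Rightarrow> real) \<times> real) \<Rightarrow> nat \<Rightarrow> (nat \<Rightarrow> real) \<Rightarrow> real" where
  "score n u \<eta> S 0 x = 0"
| "score n u \<eta> S (Suc t) x = score n u \<eta> S t x
     + \<eta> * (snd (S t) - u (score n u \<eta> S t (fst (S t)))) * kernel (ip n (fst (S t)) x)"

definition residual ::
    "nat \<Rightarrow> (real \<Rightarrow> real) \<Rightarrow> real \<Rightarrow> (nat \<Rightarrow> (nat \<Rightarrow> real) \<times> real) \<Rightarrow> nat \<Rightarrow> real" where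
  "residual n u \<eta> S t = snd (S t) - u (score n u \<eta> S t (fst (S t)))"

text \<open>The average is taken after applying \<open>u\<close>: the squared loss is convex in the
  prediction, but in general not in the score.\<close>

definition hypothesis ::
    "nat \<Rightarrow> (real \<Rightarrow> real) \<Rightarrow> real \<Rightarrow> nat \<Rightarrow> (nat \<Rightarrow> (nat \<Rightarrow> real) \<times> real) \<Rightarrow> (nat \<Rightarrow> real) \<Rightarrow> real" where
  "hypothesis n u \<eta> m S x = (\<Sum>t<m. u (score n u \<eta> S t x)) / real m"

lemma score_eq_sum:
  "score n u \<eta> S t x = (\<Sum>s<t. \<eta> * residual n u \<eta> S s * kernel (ip n (fst (S s)) x))"
  by (induction t) (auto simp: residual_def)

text \<open>The iterate \<open>t\<close> has not seen example \<open>t\<close>, which is therefore a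
  fresh sample for it.\<close>

lemma score_cong: "(\<And>s. s < t \<Longrightarrow> S s = S' s) \<Longrightarrow> score n u \<eta> S t x = score n u \<eta> S' t x"
  by (induction t arbitrary: x) auto

text \<open>In the reproducing kernel Hilbert space, \<open>potential n u \<eta> v V S t\<close> is the squared distance of the
  \<open>t\<close>-th iterate from \<open>v\<close> (with the squared norm of \<open>v\<close> replaced by \<open>V\<close>).\<close>

primrec potential ::
    "nat \<Rightarrow> (real \<Rightarrow> real) \<Rightarrow> real \<Rightarrow> ((nat \<Rightarrow> real) \<Rightarrow> real) \<Rightarrow> real \<Rightarrow>
      (nat \<Rightarrow> (nat \<Rightarrow> real) \<times> real) \<Rightarrow> nat \<Rightarrow> real" where
  "potential n u \<eta> v V S 0 = V"
| "potential n u \<eta> v V S (Suc t) = potential n u \<eta> v V S t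
     + 2 * \<eta> * residual n u \<eta> S t * (score n u \<eta> S t (fst (S t)) - v (fst (S t)))
     + 2 * \<eta>\<^sup>2 * (residual n u \<eta> S t)\<^sup>2"

lemma potential_cong:
  "(\<And>s. s < t \<Longrightarrow> S s = S' s) \<Longrightarrow> potential n u \<eta> v V S t = potential n u \<eta> v V S' t"
proof (induction t)
  case (Suc t)
  then have "score n u \<eta> S t x = score n u \<eta> S' t x" for x
    by (intro score_cong) auto
  with Suc show ?case by (simp add: residual_def)
qed simp

lemma rkhs_boundD:
  fixes t :: nat
  assumes "rkhs_bound n v V" "\<And>s. s < t \<Longrightarrow> x s \<in> unit_sphere n"
  shows "0 \<le> (\<Sum>s<t. \<Sum>r<t. \<alpha> s * \<alpha> r * kernel (ip n (x s) (x r))) - 2 * (\<Sum>s<t. \<alpha> s * v (x s)) + V"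
  by (rule assms(1)[unfolded rkhs_bound_def, rule_format]) (rule assms(2))

lemma kernel_gram_Suc:
  "(\<Sum>s<Suc t. \<Sum>r<Suc t. c s * c r * kernel (ip n (y s) (y r)))
     = (\<Sum>s<t. \<Sum>r<t. c s * c r * kernel (ip n (y s) (y r)))
       + 2 * c t * (\<Sum>s<t. c s * kernel (ip n (y s) (y t))) + (c t)\<^sup>2 * kernel (ip n (y t) (y t))"
proof -
  have "(\<Sum>r<t. c t * c r * kernel (ip n (y t) (y r))) = (\<Sum>s<t. c t * (c s * kernel (ip n (y s) (y t))))"
    by (intro sum.cong refl) (subst ip_commute, simp only: mult.assoc)
  moreover have "(\<Sum>s<t. c s * c t * kernel (ip n (y s) (y t))) = (\<Sum>s<t. c t * (c s * kernel (ip n (y s) (y t))))"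
    by (intro sum.cong refl) (simp only: mult_ac)
  ultimately show ?thesis
    by (simp add: sum.distrib power2_eq_square sum_distrib_left[symmetric])
qed

text \<open>Extending the expansion by the kernel at a new point with coefficient \<open>c\<close>
  adds \<open>2 * c\<close> times the current error at that point and
  \<open>c\<^sup>2 * kernel 1 = 2 * c\<^sup>2\<close>. With \<open>c = \<eta> * residual\<close>
  this is the recursion of \<open>potential\<close>; the points have to lie on the sphere for the
  value 2.\<close>

lemma potential_eq_form:
  assumes "\<And>s. s < t \<Longrightarrow> fst (S s) \<in> unit_sphere n"
  shows "potential n u \<eta> v V S t =
     (\<Sum>s<t. \<Sum>r<t. (\<eta> * residual n u \<eta> S s) * (\<eta> * residual n u \<eta> S r) * kernel (ip n (fst (S s)) (fst (S r))))
     - 2 * (\<Sum>s<t. (\<eta> * residual n u \<eta> S s) * v (fst (S s))) + V"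
  using assms
proof (induction t)
  case (Suc t)
  have "kernel (ip n (fst (S t)) (fst (S t))) = 2"
    using Suc.prems[of t] by (simp add: ip_self kernel_def)
  then have "potential n u \<eta> v V S (Suc t) = potential n u \<eta> v V S t
      + 2 * (\<eta> * residual n u \<eta> S t) * score n u \<eta> S t (fst (S t))
      + (\<eta> * residual n u \<eta> S t)\<^sup>2 * kernel (ip n (fst (S t)) (fst (S t)))
      - 2 * (\<eta> * residual n u \<eta> S t) * v (fst (S t))"
    by (simp add: algebra_simps power_mult_distrib)
  also have "potential n u \<eta> v V S t =
     (\<Sum>s<t. \<Sum>r<t. (\<eta> * residual n u \<eta> S s) * (\<eta> * residual n u \<eta> S r) * kernel (ip n (fst (S s)) (fst (S r))))
     - 2 * (\<Sum>s<t. (\<eta> * residual n u \<eta> S s) * v (fst (S s))) + V"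
    by (rule Suc.IH) (simp add: Suc.prems)
  also note score_eq_sum
  finally have *: "potential n u \<eta> v V S (Suc t) =
     (\<Sum>s<t. \<Sum>r<t. (\<eta> * residual n u \<eta> S s) * (\<eta> * residual n u \<eta> S r) * kernel (ip n (fst (S s)) (fst (S r))))
     - 2 * (\<Sum>s<t. (\<eta> * residual n u \<eta> S s) * v (fst (S s))) + V
     + 2 * (\<eta> * residual n u \<eta> S t) * (\<Sum>s<t. \<eta> * residual n u \<eta> S s * kernel (ip n (fst (S s)) (fst (S t))))
     + (\<eta> * residual n u \<eta> S t)\<^sup>2 * kernel (ip n (fst (S t)) (fst (S t)))
     - 2 * (\<eta> * residual n u \<eta> S t) * v (fst (S t))" .
  have arith: "A - 2 * B + V + 2 * c * T + c\<^sup>2 * k - 2 * c * w = A + 2 * c * T + c\<^sup>2 * k - 2 * (B + c * w) + V"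
    for A B c T k w :: real by (simp add: algebra_simps)
  show ?case
    unfolding * by (subst kernel_gram_Suc, subst sum.lessThan_Suc[of _ t]) (rule arith)
qed simp

lemma potential_nonneg:
  assumes "rkhs_bound n v V" "\<And>s. s < t \<Longrightarrow> fst (S s) \<in> unit_sphere n"
  shows "0 \<le> potential n u \<eta> v V S t"
  by (subst potential_eq_form) (use assms(2) in \<open>auto intro!: rkhs_boundD[OF assms(1)]\<close>)

text \<open>Evaluation at a point of the sphere has norm \<open>\<surd>2\<close>. The proof adds the multiple of the
  kernel at \<open>x\<close> that minimises the distance to \<open>v\<close>.\<close>

lemma score_error_le:
  assumes v: "rkhs_bound n v V" and S: "\<And>s. s < t \<Longrightarrow> fst (S s) \<in> unit_sphere n"
    and x: "x \<in> unit_sphere n"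
  shows "(score n u \<eta> S t x - v x)\<^sup>2 \<le> 2 * potential n u \<eta> v V S t"
proof -
  define y where "y = (\<lambda>s. if s < t then fst (S s) else x)"
  define e where "e = score n u \<eta> S t x - v x"
  define c where "c = (\<lambda>s. if s < t then \<eta> * residual n u \<eta> S s else - e / 2)"
  have "0 \<le> (\<Sum>s<Suc t. \<Sum>r<Suc t. c s * c r * kernel (ip n (y s) (y r)))
      - 2 * (\<Sum>s<Suc t. c s * v (y s)) + V"
    by (rule rkhs_boundD[OF v]) (simp add: y_def S x)
  also have "\<dots> = ((\<Sum>s<t. \<Sum>r<t. c s * c r * kernel (ip n (y s) (y r))) - 2 * (\<Sum>s<t. c s * v (y s)) + V)
      + 2 * c t * ((\<Sum>s<t. c s * kernel (ip n (y s) (y t))) - v (y t)) + (c t)\<^sup>2 * kernel (ip n (y t) (y t))"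
  proof -
    have arith: "A + 2 * c * T + k - 2 * (B + c * w) + V = (A - 2 * B + V) + 2 * c * (T - w) + k"
      for A B c T k w :: real by (simp add: algebra_simps)
    show ?thesis
      by (subst kernel_gram_Suc, subst sum.lessThan_Suc[of _ t]) (rule arith)
  qed
  also have "(\<Sum>s<t. \<Sum>r<t. c s * c r * kernel (ip n (y s) (y r))) - 2 * (\<Sum>s<t. c s * v (y s)) + V
      = potential n u \<eta> v V S t"
    by (simp add: potential_eq_form[OF S] c_def y_def)
  also have "(\<Sum>s<t. c s * kernel (ip n (y s) (y t))) - v (y t) = e"
    by (simp add: e_def score_eq_sum c_def y_def)
  also have "kernel (ip n (y t) (y t)) = 2"
    using x by (simp add: y_def ip_self kernel_def)
  also have "potential n u \<eta> v V S t + 2 * c t * e + (c t)\<^sup>2 * 2 = potential n u \<eta> v V S t - e\<^sup>2 / 2"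
    by (simp add: c_def power2_eq_square)
  finally show ?thesis by (simp add: e_def)
qed

section \<open>Measurability with respect to the product Borel algebra\<close>

lemma measurable_ip [measurable]:
  assumes [measurable]: "f \<in> measurable M (borel_vec n)" "g \<in> measurable M (borel_vec n)"
  shows "(\<lambda>x. ip n (f x) (g x)) \<in> borel_measurable M"
proof -
  have [measurable]: "(\<lambda>x. f x j) \<in> borel_measurable M" "(\<lambda>x. g x j) \<in> borel_measurable M" if "j < n" for j
    using that by auto
  show ?thesis unfolding ip_def by measurable
qed

lemma measurable_kernel [measurable]: "kernel \<in> borel_measurable borel"
  unfolding kernel_def by measurable

lemma unit_sphere_sets: "unit_sphere n \<in> sets (borel_vec n)"
proof -
  have "unit_sphere n = {x \<in> space (borel_vec n). ip n x x = 1}"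
    by (auto simp: unit_sphere_def space_PiM PiE_def ip_def L2_set_def power2_eq_square)
  then show ?thesis by simp
qed

section \<open>Generalisation bound\<close>

lemma space_distribution:
  assumes "distribution_on_sphere n D"
  shows "space D = unit_sphere n \<times> {0..1}"
proof -
  have "unit_sphere n \<subseteq> space (borel_vec n)"
    using unit_sphere_sets by (rule sets.sets_into_space)
  moreover have "space D = space (restrict_space (borel_vec n \<Otimes>\<^sub>M borel) (unit_sphere n \<times> {0..1 :: real}))"
    using assms by (intro sets_eq_imp_space_eq) (simp add: distribution_on_sphere_def)
  ultimately show ?thesis
    by (auto simp: space_restrict_space space_pair_measure)
qed

lemma measurable_distribution:
  assumes "distribution_on_sphere n D" "f \<in> measurable (borel_vec n \<Otimes>\<^sub>M borel) N"
  shows "f \<in> measurable D N"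
proof -
  have "sets D = sets (restrict_space (borel_vec n \<Otimes>\<^sub>M borel) (unit_sphere n \<times> {0..1}))"
    using assms(1) by (simp add: distribution_on_sphere_def)
  then show ?thesis
    using measurable_restrict_space1[OF assms(2)] by (simp cong: measurable_cong_sets)
qed

lemma fst_measurable_distribution: "distribution_on_sphere n D \<Longrightarrow> fst \<in> measurable D (borel_vec n)"
  by (rule measurable_distribution[OF _ measurable_fst])

lemma snd_measurable_distribution: "distribution_on_sphere n D \<Longrightarrow> snd \<in> borel_measurable D"
  by (rule measurable_distribution[OF _ measurable_snd])

text \<open>The analysis is carried out for any conditional mean of the form \<open>u (g x)\<close>.
  Of the inner layer it retains only that \<open>g\<close> is within \<open>\<xi>\<close>, on the
  sphere, of a function \<open>v\<close> with \<open>rkhs_bound n v V\<close>.\<close>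

locale glm_learning =
  fixes n :: nat and u :: "real \<Rightarrow> real" and L \<eta> :: real and D :: "((nat \<Rightarrow> real) \<times> real) measure"
    and g v :: "(nat \<Rightarrow> real) \<Rightarrow> real" and V \<xi> :: real
  assumes distribution: "distribution_on_sphere n D"
    and u_range: "range u \<subseteq> {0..1}" and u_lipschitz: "L-lipschitz_on UNIV u" and u_mono: "mono u"
    and L_pos: "L > 0" and \<eta>_pos: "\<eta> > 0" and \<xi>_nonneg: "\<xi> \<ge> 0"
    and label: "AE z in D. label_given_point n D z = u (g (fst z))"
    and g_measurable [measurable]: "g \<in> borel_measurable (borel_vec n)"
    and v_measurable [measurable]: "v \<in> borel_measurable (borel_vec n)"
    and approx: "\<And>x. x \<in> unit_sphere n \<Longrightarrow> \<bar>v x - g x\<bar> \<le> \<xi>"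
    and rkhs: "rkhs_bound n v V"
begin

sublocale prob_space D
  using distribution by (simp add: distribution_on_sphere_def)

lemma u_bounds [simp]: "0 \<le> u x" "u x \<le> 1"
  using subsetD[OF u_range rangeI[of u x]] by auto

lemma u_measurable [measurable]: "u \<in> borel_measurable borel"
  by (rule borel_measurable_mono[OF u_mono])

lemmas space_D = space_distribution[OF distribution]
  and fst_measurable [measurable] = fst_measurable_distribution[OF distribution]
  and snd_measurable [measurable] = snd_measurable_distribution[OF distribution]

text \<open>The factor \<open>f (fst z)\<close> is measurable for the algebra generated by the
  point, so the label may be replaced by its conditional expectation under the integral.\<close>

lemma integral_label:
  assumes [measurable]: "f \<in> borel_measurable (borel_vec n)"
    and B: "\<And>x. x \<in> unit_sphere n \<Longrightarrow> \<bar>f x\<bar> \<le> B"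
  shows "(\<integral>z. f (fst z) * snd z \<partial>D) = (\<integral>z. f (fst z) * u (g (fst z)) \<partial>D)"
proof -
  define F where "F = vimage_algebra (space D) fst (borel_vec n)"
  have "subalgebra D F"
    unfolding subalgebra_def F_def using fst_measurable by (simp add: measurable_iff_sets)
  then interpret finite_measure_subalgebra D F
    by unfold_locales
  have "fst \<in> measurable F (borel_vec n)"
    unfolding F_def
    by (intro measurable_vimage_algebra1 funcsetI) (rule measurable_space[OF fst_measurable])
  then have [measurable]: "(\<lambda>z. f (fst z)) \<in> borel_measurable F"
    by measurable
  have "integrable D (\<lambda>z. f (fst z) * snd z)"
  proof (rule integrable_const_bound)
    show "AE z in D. norm (f (fst z) * snd z) \<le> B * 1"
    proof (rule AE_I2)
      fix z assume "z \<in> space D"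
      then have "\<bar>f (fst z)\<bar> \<le> B" "\<bar>snd z\<bar> \<le> 1"
        using B by (auto simp: space_D)
      then show "norm (f (fst z) * snd z) \<le> B * 1"
        unfolding real_norm_def abs_mult by (intro mult_mono) auto
    qed
  qed measurable
  from real_cond_exp_intg(2)[OF this]
  have "(\<integral>z. f (fst z) * snd z \<partial>D) = (\<integral>z. f (fst z) * real_cond_exp D F snd z \<partial>D)"
    by simp
  also have "\<dots> = (\<integral>z. f (fst z) * u (g (fst z)) \<partial>D)"
    using label by (intro integral_cong_AE) (auto simp: label_given_point_def F_def)
  finally show ?thesis .
qed

definition sq_error :: "((nat \<Rightarrow> real) \<Rightarrow> real) \<Rightarrow> real" where
  "sq_error h = (\<integral>z. (h (fst z) - u (g (fst z)))\<^sup>2 \<partial>D)"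

lemma sq_error_nonneg: "0 \<le> sq_error h"
  by (simp add: sq_error_def)

text \<open>Split \<open>x - w\<close> into \<open>x - y\<close> and \<open>y - w\<close>. For a
  monotone Lipschitz \<open>u\<close> the product of \<open>u x - u y\<close> and
  \<open>x - y\<close> dominates \<open>(u x - u y)\<^sup>2 / L\<close>; the second part costs at
  most \<open>\<xi>\<close> because \<open>u\<close> has range in the unit interval. It is applied
  with \<open>x\<close> the score, \<open>y\<close> the value of \<open>g\<close> and
  \<open>w\<close> the value of \<open>v\<close>.\<close>

lemma correlation_le:
  assumes "\<bar>w - y\<bar> \<le> \<xi>"
  shows "(u y - u x) * (x - w) \<le> \<xi> - (u x - u y)\<^sup>2 / L"
proof -
  have lip: "\<bar>u x - u y\<bar> \<le> L * \<bar>x - y\<bar>"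
    using lipschitz_onD[OF u_lipschitz, of x y] by (simp add: dist_real_def)
  have "(u x - u y)\<^sup>2 = \<bar>u x - u y\<bar> * \<bar>u x - u y\<bar>"
    by (simp add: power2_eq_square)
  also have "\<dots> \<le> \<bar>u x - u y\<bar> * (L * \<bar>x - y\<bar>)"
    by (intro mult_left_mono lip) auto
  also have "\<dots> = L * ((u x - u y) * (x - y))"
    using monoD[OF u_mono, of x y] monoD[OF u_mono, of y x] by (auto simp: abs_if algebra_simps)
  finally have "(u x - u y)\<^sup>2 / L \<le> (u x - u y) * (x - y)"
    using L_pos by (simp add: divide_le_eq mult.commute)
  moreover have "(u y - u x) * (y - w) \<le> \<xi>"
  proof -
    have "\<bar>u y - u x\<bar> \<le> 1"
      using u_bounds[of x] u_bounds[of y] by linarith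
    then have "\<bar>u y - u x\<bar> * \<bar>y - w\<bar> \<le> 1 * \<xi>"
      using assms by (intro mult_mono) auto
    then show ?thesis by (simp add: abs_mult[symmetric])
  qed
  ultimately show ?thesis by (simp add: algebra_simps)
qed

section \<open>Conditional exponential moment of one update\<close>

lemma integrable_bounded_fst:
  assumes "f \<in> borel_measurable D" "\<And>z. z \<in> space D \<Longrightarrow> \<bar>f z\<bar> \<le> (B::real)"
  shows "integrable D f"
  using assms by (intro integrable_const_bound[of _ B] AE_I2) auto

text \<open>Here \<open>d\<close> is the potential and \<open>s\<close> the score before the update.
  The linear term \<open>Z\<close> of the increment is bounded by \<open>sqrt (2 * d)\<close>, so
  Hoeffding's lemma with exponent \<open>l = 2 * \<eta> * \<theta>\<close> costs
  \<open>4 * \<eta>\<^sup>2 * \<theta>\<^sup>2 * d\<close>, a multiple of the potential. The mean of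
  \<open>Z\<close> supplies the negative error term.\<close>

lemma step_exp_moment:
  assumes [measurable]: "s \<in> borel_measurable (borel_vec n)" and \<theta>: "\<theta> > 0"
    and s: "\<And>x. x \<in> unit_sphere n \<Longrightarrow> (s x - v x)\<^sup>2 \<le> 2 * d" and d: "d \<ge> 0"
  shows "(\<integral>\<^sup>+z. ennreal (exp (\<theta> * (d + 2 * \<eta> * (snd z - u (s (fst z))) * (s (fst z) - v (fst z))
       + 2 * \<eta>\<^sup>2 * (snd z - u (s (fst z)))\<^sup>2))) \<partial>D)
    \<le> ennreal (exp ((\<theta> + 4 * \<eta>\<^sup>2 * \<theta>\<^sup>2) * d + \<theta> * (2 * \<eta>\<^sup>2 + 2 * \<eta> * \<xi>)
       - \<theta> * (2 * \<eta> / L * sq_error (\<lambda>x. u (s x)))))"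
proof -
  define c where "c = sqrt (2 * d)"
  define \<beta> where "\<beta> = (\<lambda>z. snd z - u (s (fst z)))"
  define Z where "Z = (\<lambda>z. \<beta> z * (s (fst z) - v (fst z)))"
  have c: "c\<^sup>2 = 2 * d" "c \<ge> 0" using d by (auto simp: c_def)
  have sv: "\<bar>s x - v x\<bar> \<le> c" if "x \<in> unit_sphere n" for x
    using s[OF that] unfolding c_def by (rule real_le_rsqrt[of "\<bar>s x - v x\<bar>", simplified])
  have \<beta>: "\<bar>\<beta> z\<bar> \<le> 1" if "z \<in> space D" for z
  proof -
    have "0 \<le> snd z" "snd z \<le> 1" using that by (auto simp: space_D)
    then show ?thesis
      using u_bounds[of "s (fst z)"] unfolding \<beta>_def by linarith
  qed
  have [measurable]: "\<beta> \<in> borel_measurable D" "Z \<in> borel_measurable D"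
    unfolding \<beta>_def Z_def by measurable
  have Z: "\<bar>Z z\<bar> \<le> c" if "z \<in> space D" for z
  proof -
    have "\<bar>\<beta> z\<bar> * \<bar>s (fst z) - v (fst z)\<bar> \<le> 1 * c"
      using that by (intro mult_mono \<beta> sv) (auto simp: space_D)
    then show ?thesis by (simp add: Z_def abs_mult)
  qed
  interpret Z: interval_bounded_random_variable D Z "-c" c
    by unfold_locales (use Z in \<open>auto intro!: AE_I2 simp: abs_le_iff minus_le_iff\<close>)
  \<comment> \<open>The label enters \<open>Z\<close> linearly, multiplied by a function of the
    point. After it is replaced by its conditional mean, \<open>correlation_le\<close> applies
    pointwise.\<close>
  have EZ: "expectation Z \<le> \<xi> - sq_error (\<lambda>x. u (s x)) / L"
  proof -
    have us: "\<bar>u y * (s x - v x)\<bar> \<le> 1 * c" if "x \<in> unit_sphere n" for x y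
      unfolding abs_mult using that by (intro mult_mono sv) auto
    have lab: "\<bar>(s x - v x) * y\<bar> \<le> c * 1" if "x \<in> unit_sphere n" "0 \<le> y" "y \<le> 1" for x y
      unfolding abs_mult using that c by (intro mult_mono sv) auto
    have int: "integrable D (\<lambda>z. u (s (fst z)) * (s (fst z) - v (fst z)))"
      "integrable D (\<lambda>z. (s (fst z) - v (fst z)) * u (g (fst z)))"
      "integrable D (\<lambda>z. (s (fst z) - v (fst z)) * snd z)"
      by (rule integrable_bounded_fst[where B = c]; use us lab in \<open>force simp: space_D\<close>)+
    have int2: "integrable D (\<lambda>z. (u (s (fst z)) - u (g (fst z)))\<^sup>2)"
    proof (rule integrable_bounded_fst[where B = 1])
      show "\<bar>(u (s (fst z)) - u (g (fst z)))\<^sup>2\<bar> \<le> 1" for z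
      proof -
        have "\<bar>u (s (fst z)) - u (g (fst z))\<bar> \<le> 1"
          using u_bounds[of "s (fst z)"] u_bounds[of "g (fst z)"] by linarith
        then show ?thesis by (simp add: abs_square_le_1)
      qed
    qed measurable
    have "expectation Z = (\<integral>z. (s (fst z) - v (fst z)) * snd z - u (s (fst z)) * (s (fst z) - v (fst z)) \<partial>D)"
      by (intro Bochner_Integration.integral_cong) (auto simp: Z_def \<beta>_def algebra_simps)
    also have "\<dots> = (\<integral>z. (s (fst z) - v (fst z)) * snd z \<partial>D) - (\<integral>z. u (s (fst z)) * (s (fst z) - v (fst z)) \<partial>D)"
      by (intro Bochner_Integration.integral_diff int)
    also have "(\<integral>z. (s (fst z) - v (fst z)) * snd z \<partial>D) = (\<integral>z. (s (fst z) - v (fst z)) * u (g (fst z)) \<partial>D)"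
      by (rule integral_label[where B = c]) (use sv in auto)
    also have "\<dots> - (\<integral>z. u (s (fst z)) * (s (fst z) - v (fst z)) \<partial>D)
        = (\<integral>z. (s (fst z) - v (fst z)) * u (g (fst z)) - u (s (fst z)) * (s (fst z) - v (fst z)) \<partial>D)"
      by (intro Bochner_Integration.integral_diff[symmetric] int)
    also have "\<dots> \<le> (\<integral>z. \<xi> - (u (s (fst z)) - u (g (fst z)))\<^sup>2 / L \<partial>D)"
    proof (rule integral_mono)
      fix z assume "z \<in> space D"
      then have "\<bar>v (fst z) - g (fst z)\<bar> \<le> \<xi>" by (intro approx) (auto simp: space_D)
      from correlation_le[OF this, of "s (fst z)"]
      show "(s (fst z) - v (fst z)) * u (g (fst z)) - u (s (fst z)) * (s (fst z) - v (fst z))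
          \<le> \<xi> - (u (s (fst z)) - u (g (fst z)))\<^sup>2 / L"
        by (simp add: algebra_simps)
    qed (use int int2 in auto)
    also have "\<dots> = \<xi> - sq_error (\<lambda>x. u (s x)) / L"
      using int2 by (simp add: sq_error_def prob_space)
    finally show ?thesis .
  qed
  define l where "l = 2 * \<eta> * \<theta>"
  have l: "l > 0" using \<eta>_pos \<theta> by (simp add: l_def)
  define K where "K = \<theta> * d + \<theta> * (2 * \<eta>\<^sup>2) + l * (\<xi> - sq_error (\<lambda>x. u (s x)) / L)"
  have "(\<integral>\<^sup>+z. ennreal (exp (\<theta> * (d + 2 * \<eta> * (snd z - u (s (fst z))) * (s (fst z) - v (fst z))
       + 2 * \<eta>\<^sup>2 * (snd z - u (s (fst z)))\<^sup>2))) \<partial>D)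
     \<le> (\<integral>\<^sup>+z. ennreal (exp K) * ennreal (exp (l * (Z z - expectation Z))) \<partial>D)"
  proof (rule nn_integral_mono)
    fix z assume z: "z \<in> space D"
    have "(\<beta> z)\<^sup>2 \<le> 1"
      using \<beta>[OF z] by (simp add: abs_square_le_1)
    then have "\<theta> * (2 * \<eta>\<^sup>2 * (\<beta> z)\<^sup>2) \<le> \<theta> * (2 * \<eta>\<^sup>2 * 1)"
      using \<theta> by (intro mult_left_mono) auto
    moreover have "l * expectation Z \<le> l * (\<xi> - sq_error (\<lambda>x. u (s x)) / L)"
      using EZ l by (intro mult_left_mono) auto
    moreover have "\<theta> * (d + 2 * \<eta> * \<beta> z * (s (fst z) - v (fst z)) + 2 * \<eta>\<^sup>2 * (\<beta> z)\<^sup>2)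
        = \<theta> * d + l * Z z + \<theta> * (2 * \<eta>\<^sup>2 * (\<beta> z)\<^sup>2)"
      by (simp add: l_def Z_def algebra_simps)
    ultimately have "\<theta> * (d + 2 * \<eta> * \<beta> z * (s (fst z) - v (fst z)) + 2 * \<eta>\<^sup>2 * (\<beta> z)\<^sup>2)
        \<le> K + l * (Z z - expectation Z)"
      unfolding K_def right_diff_distrib[of l "Z z"] by linarith
    then show "ennreal (exp (\<theta> * (d + 2 * \<eta> * (snd z - u (s (fst z))) * (s (fst z) - v (fst z))
       + 2 * \<eta>\<^sup>2 * (snd z - u (s (fst z)))\<^sup>2)))
       \<le> ennreal (exp K) * ennreal (exp (l * (Z z - expectation Z)))"
      by (simp add: \<beta>_def ennreal_mult'[symmetric] exp_add[symmetric])
  qed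
  also have "\<dots> = ennreal (exp K) * (\<integral>\<^sup>+z. ennreal (exp (l * (Z z - expectation Z))) \<partial>D)"
    by (rule nn_integral_cmult) measurable
  also have "\<dots> \<le> ennreal (exp K) * ennreal (exp (l\<^sup>2 * (c - - c)\<^sup>2 / 8))"
    by (intro mult_left_mono Z.Hoeffdings_lemma_nn_integral l) auto
  also have "\<dots> = ennreal (exp (K + l\<^sup>2 * (c - - c)\<^sup>2 / 8))"
    by (simp add: ennreal_mult'[symmetric] exp_add)
  also have "l\<^sup>2 * (c - - c)\<^sup>2 / 8 = 4 * \<eta>\<^sup>2 * \<theta>\<^sup>2 * d"
  proof -
    have "(c - - c)\<^sup>2 = 4 * c\<^sup>2" by (simp add: power2_eq_square algebra_simps)
    then show ?thesis by (simp add: c l_def power_mult_distrib)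
  qed
  also have "K + 4 * \<eta>\<^sup>2 * \<theta>\<^sup>2 * d = (\<theta> + 4 * \<eta>\<^sup>2 * \<theta>\<^sup>2) * d + \<theta> * (2 * \<eta>\<^sup>2 + 2 * \<eta> * \<xi>)
       - \<theta> * (2 * \<eta> / L * sq_error (\<lambda>x. u (s x)))"
    using L_pos by (simp add: K_def l_def field_simps)
  finally show ?thesis .
qed

text \<open>Sample and query point are arbitrary measurable maps \<open>f\<close> and
  \<open>h\<close>, because the recursion evaluates the score at a point of the sample
  itself.\<close>

lemma score_measurable [measurable]:
  assumes [measurable]: "f \<in> measurable M (Pi\<^sub>M {..<m} (\<lambda>_. D))" "h \<in> measurable M (borel_vec n)"
    and "t \<le> m"
  shows "(\<lambda>w. score n u \<eta> (f w) t (h w)) \<in> borel_measurable M"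
  using assms(2,3)
proof (induction t arbitrary: h)
  case (Suc t)
  note [measurable] = Suc.prems(1)
  have [measurable]: "(\<lambda>w. f w t) \<in> measurable M D"
    using Suc.prems(2) by (intro measurable_compose[OF assms(1) measurable_component_singleton]) auto
  have [measurable]: "(\<lambda>w. score n u \<eta> (f w) t (h w)) \<in> borel_measurable M"
    "(\<lambda>w. score n u \<eta> (f w) t (fst (f w t))) \<in> borel_measurable M"
    using Suc.prems(2) by (auto intro!: Suc.IH)
  show ?case by simp
qed simp

lemma potential_measurable [measurable]:
  "t \<le> m \<Longrightarrow> (\<lambda>S. potential n u \<eta> v V S t) \<in> borel_measurable (Pi\<^sub>M {..<m} (\<lambda>_. D))"
proof (induction t)
  case (Suc t)
  have [measurable]: "(\<lambda>S. S t) \<in> measurable (Pi\<^sub>M {..<m} (\<lambda>_. D)) D"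
    using Suc.prems by (intro measurable_component_singleton) auto
  have [measurable]: "(\<lambda>S. potential n u \<eta> v V S t) \<in> borel_measurable (Pi\<^sub>M {..<m} (\<lambda>_. D))"
    using Suc by simp
  have [measurable]: "(\<lambda>S. score n u \<eta> S t (fst (S t))) \<in> borel_measurable (Pi\<^sub>M {..<m} (\<lambda>_. D))"
    using Suc.prems by (intro score_measurable[where m = m]) auto
  show ?case unfolding potential.simps residual_def by measurable
qed simp

lemma score_error_measurable [measurable]:
  assumes "t \<le> m"
  shows "(\<lambda>S. sq_error (\<lambda>x. u (score n u \<eta> S t x))) \<in> borel_measurable (Pi\<^sub>M {..<m} (\<lambda>_. D))"
proof -
  have [measurable]: "(\<lambda>w. score n u \<eta> (fst w) t (fst (snd w))) \<in> borel_measurable (Pi\<^sub>M {..<m} (\<lambda>_. D) \<Otimes>\<^sub>M D)"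
    using assms by (intro score_measurable) auto
  show ?thesis unfolding sq_error_def by measurable
qed

section \<open>From single updates to a tail bound for the average error\<close>

abbreviation sample_measure :: "nat \<Rightarrow> (nat \<Rightarrow> (nat \<Rightarrow> real) \<times> real) measure" where
  "sample_measure m \<equiv> Pi\<^sub>M {..<m} (\<lambda>_. D)"

abbreviation err :: "(nat \<Rightarrow> (nat \<Rightarrow> real) \<times> real) \<Rightarrow> nat \<Rightarrow> real" where
  "err S t \<equiv> sq_error (\<lambda>x. u (score n u \<eta> S t x))"

lemma sample_on_sphere: "S \<in> space (sample_measure m) \<Longrightarrow> s < m \<Longrightarrow> fst (S s) \<in> unit_sphere n"
  using PiE_mem[of S "{..<m}" "\<lambda>_. space D" s] by (auto simp: space_PiM space_D mem_Times_iff)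

text \<open>The variance of a step is proportional to the potential;
  decreasing the exponent \<open>\<theta>\<close> from step to step compensates for this.\<close>

lemma exp_supermartingale:
  assumes \<theta>: "\<And>t. \<theta> t > 0" "\<And>t. \<theta> (Suc t) + 4 * \<eta>\<^sup>2 * (\<theta> (Suc t))\<^sup>2 \<le> \<theta> t"
  shows "(\<integral>\<^sup>+S. ennreal (exp (\<theta> t * potential n u \<eta> v V S t
        + (\<Sum>s<t. \<theta> (Suc s) * (2 * \<eta> / L * err S s - (2 * \<eta>\<^sup>2 + 2 * \<eta> * \<xi>))))) \<partial>sample_measure t)
    \<le> ennreal (exp (\<theta> 0 * V))"
proof (induction t)
  case 0
  then show ?case by (simp add: PiM_empty)
next
  case (Suc t)
  interpret product_prob_space "\<lambda>_. D" "UNIV :: nat set" by unfold_locales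
  define A where "A = (\<lambda>S t. \<Sum>s<t. \<theta> (Suc s) * (2 * \<eta> / L * err S s - (2 * \<eta>\<^sup>2 + 2 * \<eta> * \<xi>)))"
  have [measurable]: "(\<lambda>S. A S t) \<in> borel_measurable (sample_measure m)" if "t \<le> m" for t m
    unfolding A_def using that
    by (intro borel_measurable_sum borel_measurable_times borel_measurable_diff borel_measurable_const
        score_error_measurable) auto
  have upd: "score n u \<eta> (S(t := z)) s x = score n u \<eta> S s x" if "s \<le> t" for S z s x
    by (rule score_cong) (use that in auto)
  have pupd: "potential n u \<eta> v V (S(t := z)) t = potential n u \<eta> v V S t" for S z
    by (rule potential_cong) auto
  have ins: "insert t {..<t} = {..<Suc t}" by auto
  \<comment> \<open>Fubini: the first \<open>t\<close> examples are fixed while example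
    \<open>t\<close> is integrated, so score and potential before the update are constants of the
    inner integral.\<close>
  have "(\<integral>\<^sup>+S. ennreal (exp (\<theta> (Suc t) * potential n u \<eta> v V S (Suc t) + A S (Suc t))) \<partial>sample_measure (Suc t))
     = (\<integral>\<^sup>+S. \<integral>\<^sup>+z. ennreal (exp (\<theta> (Suc t) * potential n u \<eta> v V (S(t := z)) (Suc t) + A (S(t := z)) (Suc t))) \<partial>D \<partial>sample_measure t)"
    unfolding ins[symmetric]
    by (rule product_nn_integral_insert) (auto simp: ins simp del: potential.simps)
  also have "\<dots> \<le> (\<integral>\<^sup>+S. ennreal (exp (\<theta> t * potential n u \<eta> v V S t + A S t)) \<partial>sample_measure t)"
  proof (rule nn_integral_mono)
    fix S assume S: "S \<in> space (sample_measure t)"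
    define d where "d = potential n u \<eta> v V S t"
    define s where "s = (\<lambda>x. score n u \<eta> S t x)"
    have sph: "fst (S r) \<in> unit_sphere n" if "r < t" for r
      using S that by (rule sample_on_sphere)
    have d: "d \<ge> 0" unfolding d_def by (rule potential_nonneg[OF rkhs sph])
    have s_meas [measurable]: "s \<in> borel_measurable (borel_vec n)"
      unfolding s_def by (rule score_measurable[of "\<lambda>_. S" _ t]) (use S in auto)
    have [measurable]: "(\<lambda>z. ennreal (exp (\<theta> (Suc t) * (d + 2 * \<eta> * (snd z - u (s (fst z))) * (s (fst z) - v (fst z))
       + 2 * \<eta>\<^sup>2 * (snd z - u (s (fst z)))\<^sup>2)))) \<in> borel_measurable D"
      by measurable
    \<comment> \<open>Even the last summand, the error of iterate \<open>t\<close>, depends only on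
      the examples before \<open>t\<close>.\<close>
    have "A (S(t := z)) (Suc t) = A S (Suc t)" for z
      unfolding A_def by (intro sum.cong refl) (simp add: upd)
    then have "(\<integral>\<^sup>+z. ennreal (exp (\<theta> (Suc t) * potential n u \<eta> v V (S(t := z)) (Suc t) + A (S(t := z)) (Suc t))) \<partial>D)
       = (\<integral>\<^sup>+z. ennreal (exp (A S (Suc t))) * ennreal (exp (\<theta> (Suc t) * (d
           + 2 * \<eta> * (snd z - u (s (fst z))) * (s (fst z) - v (fst z))
           + 2 * \<eta>\<^sup>2 * (snd z - u (s (fst z)))\<^sup>2))) \<partial>D)"
      by (simp add: upd pupd d_def s_def residual_def ennreal_mult'[symmetric] exp_add[symmetric] add.commute)
    also have "\<dots> = ennreal (exp (A S (Suc t))) * (\<integral>\<^sup>+z. ennreal (exp (\<theta> (Suc t) * (d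
           + 2 * \<eta> * (snd z - u (s (fst z))) * (s (fst z) - v (fst z))
           + 2 * \<eta>\<^sup>2 * (snd z - u (s (fst z)))\<^sup>2))) \<partial>D)"
      by (rule nn_integral_cmult) measurable
    also have "\<dots> \<le> ennreal (exp (A S (Suc t))) *
        ennreal (exp ((\<theta> (Suc t) + 4 * \<eta>\<^sup>2 * (\<theta> (Suc t))\<^sup>2) * d + \<theta> (Suc t) * (2 * \<eta>\<^sup>2 + 2 * \<eta> * \<xi>)
       - \<theta> (Suc t) * (2 * \<eta> / L * sq_error (\<lambda>x. u (s x)))))"
      by (intro mult_left_mono step_exp_moment s_meas \<theta> d)
         (use score_error_le[where S = S and t = t, OF rkhs sph] in \<open>auto simp: s_def d_def\<close>)
    also have "\<dots> = ennreal (exp ((\<theta> (Suc t) + 4 * \<eta>\<^sup>2 * (\<theta> (Suc t))\<^sup>2) * d + A S t))"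
      by (simp add: ennreal_mult'[symmetric] exp_add[symmetric] A_def s_def algebra_simps)
    also have "\<dots> \<le> ennreal (exp (\<theta> t * d + A S t))"
      using mult_right_mono[OF \<theta>(2) d] by (intro ennreal_leI) simp
    finally show "(\<integral>\<^sup>+z. ennreal (exp (\<theta> (Suc t) * potential n u \<eta> v V (S(t := z)) (Suc t) + A (S(t := z)) (Suc t))) \<partial>D)
       \<le> ennreal (exp (\<theta> t * potential n u \<eta> v V S t + A S t))"
      by (simp add: d_def)
  qed
  also have "\<dots> \<le> ennreal (exp (\<theta> 0 * V))"
    using Suc.IH by (simp add: A_def)
  finally show ?case by (simp add: A_def)
qed

text \<open>Convexity of the square, applied at every point in the form of the Cauchy-Schwarz
  inequality.\<close>

lemma hypothesis_error_le:
  assumes S: "S \<in> space (sample_measure m)" and m: "m > 0"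
  shows "sq_error (hypothesis n u \<eta> m S) \<le> (\<Sum>t<m. err S t) / real m"
proof -
  define a where "a = (\<lambda>t (z :: (nat \<Rightarrow> real) \<times> real). u (score n u \<eta> S t (fst z)) - u (g (fst z)))"
  have a1: "\<bar>(a t z)\<^sup>2\<bar> \<le> 1" for t z
  proof -
    have "\<bar>a t z\<bar> \<le> 1"
      using u_bounds[of "score n u \<eta> S t (fst z)"] u_bounds[of "g (fst z)"]
      unfolding a_def by linarith
    then show ?thesis by (simp add: abs_square_le_1)
  qed
  have a_meas [measurable]: "a t \<in> borel_measurable D" if "t < m" for t
  proof -
    have [measurable]: "(\<lambda>z. score n u \<eta> S t (fst z)) \<in> borel_measurable D"
      by (rule score_measurable[where m = m]) (use S that in auto)
    show ?thesis unfolding a_def by measurable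
  qed
  have int: "integrable D (\<lambda>z. (a t z)\<^sup>2)" if "t < m" for t
  proof (rule integrable_bounded_fst)
    show "(\<lambda>z. (a t z)\<^sup>2) \<in> borel_measurable D"
      using a_meas[OF that] by measurable
    show "\<bar>(a t z)\<^sup>2\<bar> \<le> 1" for z by (rule a1)
  qed
  have "sq_error (hypothesis n u \<eta> m S) \<le> (\<integral>z. (\<Sum>t<m. (a t z)\<^sup>2) / real m \<partial>D)"
    unfolding sq_error_def
  proof (rule integral_mono_AE')
    show "integrable D (\<lambda>z. (\<Sum>t<m. (a t z)\<^sup>2) / real m)"
      by (intro integrable_divide_zero Bochner_Integration.integrable_sum int) simp
    show "AE z in D. (hypothesis n u \<eta> m S (fst z) - u (g (fst z)))\<^sup>2 \<le> (\<Sum>t<m. (a t z)\<^sup>2) / real m"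
    proof (rule AE_I2)
      fix z
      have "hypothesis n u \<eta> m S (fst z) - u (g (fst z)) = (\<Sum>t<m. a t z) / real m"
        using m by (simp add: hypothesis_def a_def sum_subtractf diff_divide_distrib)
      then have "(hypothesis n u \<eta> m S (fst z) - u (g (fst z)))\<^sup>2 = (\<Sum>t<m. a t z)\<^sup>2 / (real m)\<^sup>2"
        by (simp add: power_divide)
      also have "\<dots> \<le> ((\<Sum>t<m. (a t z)\<^sup>2) * real m) / (real m)\<^sup>2"
        using sum_squared_le_sum_of_squares[of "\<lambda>t. a t z" "{..<m}"]
        by (intro divide_right_mono) auto
      finally show "(hypothesis n u \<eta> m S (fst z) - u (g (fst z)))\<^sup>2 \<le> (\<Sum>t<m. (a t z)\<^sup>2) / real m"
        using m by (simp add: power2_eq_square)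
    qed
    show "AE z in D. 0 \<le> (\<Sum>t<m. (a t z)\<^sup>2) / real m"
      by (intro AE_I2 divide_nonneg_nonneg sum_nonneg) auto
  qed
  also have "\<dots> = (\<Sum>t<m. \<integral>z. (a t z)\<^sup>2 \<partial>D) / real m"
    by (subst integral_divide_zero, subst Bochner_Integration.integral_sum) (auto intro: int)
  finally show ?thesis by (simp add: sq_error_def a_def)
qed

lemma hypothesis_error_measurable [measurable]:
  "(\<lambda>S. sq_error (hypothesis n u \<eta> m S)) \<in> borel_measurable (sample_measure m)"
proof -
  have [measurable]: "(\<lambda>w. score n u \<eta> (fst w) t (fst (snd w))) \<in> borel_measurable (sample_measure m \<Otimes>\<^sub>M D)"
    if "t < m" for t
    using that by (intro score_measurable) auto
  have [measurable]: "(\<lambda>w. hypothesis n u \<eta> m (fst w) (fst (snd w))) \<in> borel_measurable (sample_measure m \<Otimes>\<^sub>M D)"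
    unfolding hypothesis_def
    by (intro borel_measurable_divide borel_measurable_sum borel_measurable_const) simp
  show ?thesis unfolding sq_error_def by measurable
qed

lemma hypothesis_integrable:
  assumes S: "S \<in> space (sample_measure m)"
  shows "integrable D (\<lambda>z. (hypothesis n u \<eta> m S (fst z) - u (g (fst z)))\<^sup>2)"
proof (rule integrable_bounded_fst)
  have "(\<lambda>z. score n u \<eta> S t (fst z)) \<in> borel_measurable D" if "t < m" for t
    by (rule score_measurable[where m = m]) (use S that in auto)
  then have [measurable]: "(\<lambda>z. hypothesis n u \<eta> m S (fst z)) \<in> borel_measurable D"
    unfolding hypothesis_def
    by (intro borel_measurable_divide borel_measurable_sum borel_measurable_const) simp
  show "(\<lambda>z. (hypothesis n u \<eta> m S (fst z) - u (g (fst z)))\<^sup>2) \<in> borel_measurable D"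
    by measurable
  fix z
  have "(\<Sum>t<m. u (score n u \<eta> S t (fst z))) \<le> (\<Sum>t<m. 1)"
    by (intro sum_mono) simp
  then have "0 \<le> hypothesis n u \<eta> m S (fst z)" "hypothesis n u \<eta> m S (fst z) \<le> 1"
    by (auto simp: hypothesis_def divide_simps intro!: divide_nonneg_nonneg sum_nonneg)
  then have "\<bar>hypothesis n u \<eta> m S (fst z) - u (g (fst z))\<bar> \<le> 1"
    using u_bounds[of "g (fst z)"] by linarith
  then show "\<bar>(hypothesis n u \<eta> m S (fst z) - u (g (fst z)))\<^sup>2\<bar> \<le> 1"
    by (simp add: abs_square_le_1)
qed

lemma average_error_bound:
  assumes m: "m > 0" and \<delta>: "\<delta> > 0"
  shows "measure (sample_measure m) {S \<in> space (sample_measure m).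
     (\<Sum>t<m. err S t) / real m \<le> 2 * L * (\<eta> + \<xi>) + L * V / (\<eta> * real m) + 4 * \<eta> * L * ln (1 / \<delta>)} \<ge> 1 - \<delta>"
proof -
  interpret S: prob_space "sample_measure m"
    by (intro prob_space_PiM) unfold_locales
  \<comment> \<open>The value at which the lower bound for \<open>Y\<close> equals
    \<open>\<theta> 0 * V + ln (1 / \<delta>)\<close>, so that Markov's inequality gives failure
    probability \<open>\<delta>\<close>.\<close>
  define B where "B = 2 * L * (\<eta> + \<xi>) + L * V / (\<eta> * real m) + 4 * \<eta> * L * ln (1 / \<delta>)"
  define E where "E = (\<lambda>S. (\<Sum>t<m. err S t) / real m)"
  \<comment> \<open>The required decrease follows from telescoping,
    \<open>1 / (q + 1)\<^sup>2 \<le> 1 / q - 1 / (q + 1)\<close>. Starting at \<open>m\<close>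
    instead of 1 keeps all \<open>m\<close> exponents within a factor 2 of each other.\<close>
  define \<theta> where "\<theta> = (\<lambda>t. 1 / (4 * \<eta>\<^sup>2 * (real m + real t)))"
  define Y where "Y = (\<lambda>S. \<theta> m * potential n u \<eta> v V S m
        + (\<Sum>s<m. \<theta> (Suc s) * (2 * \<eta> / L * err S s - (2 * \<eta>\<^sup>2 + 2 * \<eta> * \<xi>))))"
  have [measurable]: "E \<in> borel_measurable (sample_measure m)"
    unfolding E_def
    by (intro borel_measurable_divide borel_measurable_sum borel_measurable_const score_error_measurable) auto
  have [measurable]: "Y \<in> borel_measurable (sample_measure m)"
    unfolding Y_def
    by (intro borel_measurable_add borel_measurable_sum borel_measurable_times borel_measurable_diff
        borel_measurable_const score_error_measurable potential_measurable) auto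
  have \<theta>0: "\<theta> t > 0" for t using m \<eta>_pos by (simp add: \<theta>_def)
  have \<theta>_step: "\<theta> (Suc t) + 4 * \<eta>\<^sup>2 * (\<theta> (Suc t))\<^sup>2 \<le> \<theta> t" for t
  proof -
    define q where "q = real m + real t"
    define a where "a = 4 * \<eta>\<^sup>2"
    have q: "q > 0" using m by (simp add: q_def)
    have a: "a > 0" using \<eta>_pos by (simp add: a_def)
    have "a * (1 / (a * (q + 1)))\<^sup>2 = 1 / (a * (q + 1) * (q + 1))"
      using a q by (simp add: power2_eq_square)
    also have "\<dots> \<le> 1 / (a * q * (q + 1))"
      using a q by (intro divide_left_mono mult_right_mono mult_pos_pos) auto
    also have "\<dots> = 1 / (a * q) - 1 / (a * (q + 1))"
      using a q by (simp add: divide_simps)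
    finally show ?thesis
      by (simp add: \<theta>_def q_def a_def add_ac)
  qed
  have Y_le: "(\<integral>\<^sup>+S. ennreal (exp (Y S)) \<partial>sample_measure m) \<le> ennreal (exp (\<theta> 0 * V))"
    unfolding Y_def by (rule exp_supermartingale[where \<theta> = \<theta>, OF \<theta>0 \<theta>_step])
  have lower: "E S / (4 * \<eta> * L) - (\<eta> + \<xi>) / (2 * \<eta>) \<le> Y S" if S: "S \<in> space (sample_measure m)" for S
  proof -
    have sph: "fst (S r) \<in> unit_sphere n" if "r < m" for r
      using S that by (rule sample_on_sphere)
    have "0 \<le> \<theta> m * potential n u \<eta> v V S m"
      using \<theta>0[of m] potential_nonneg[OF rkhs sph] by simp
    \<comment> \<open>The exponent is bounded from below in front of the error and from above in
      front of the cost; the factor 2 between the two bounds is the one between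
      \<open>\<theta> 0\<close> and \<open>\<theta> m\<close>.\<close>
    moreover have "(\<Sum>s<m. 1 / (8 * \<eta>\<^sup>2 * real m) * (2 * \<eta> / L * err S s) - 1 / (4 * \<eta>\<^sup>2 * real m) * (2 * \<eta>\<^sup>2 + 2 * \<eta> * \<xi>))
        \<le> (\<Sum>s<m. \<theta> (Suc s) * (2 * \<eta> / L * err S s - (2 * \<eta>\<^sup>2 + 2 * \<eta> * \<xi>)))"
    proof (rule sum_mono)
      fix s assume "s \<in> {..<m}"
      then have "4 * \<eta>\<^sup>2 * (real m + real (Suc s)) \<le> 4 * \<eta>\<^sup>2 * (2 * real m)"
        "4 * \<eta>\<^sup>2 * real m \<le> 4 * \<eta>\<^sup>2 * (real m + real (Suc s))"
        by (intro mult_left_mono; auto)+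
      then have "1 / (4 * \<eta>\<^sup>2 * (2 * real m)) \<le> \<theta> (Suc s)" "\<theta> (Suc s) \<le> 1 / (4 * \<eta>\<^sup>2 * real m)"
        unfolding \<theta>_def using m \<eta>_pos by (auto intro!: divide_left_mono mult_pos_pos simp del: of_nat_Suc)
      then have "1 / (8 * \<eta>\<^sup>2 * real m) \<le> \<theta> (Suc s)" "\<theta> (Suc s) \<le> 1 / (4 * \<eta>\<^sup>2 * real m)"
        by (simp_all add: mult.assoc mult.left_commute)
      moreover have "0 \<le> 2 * \<eta> / L * err S s" "0 \<le> 2 * \<eta>\<^sup>2 + 2 * \<eta> * \<xi>"
        using \<eta>_pos L_pos \<xi>_nonneg sq_error_nonneg by auto
      ultimately have "1 / (8 * \<eta>\<^sup>2 * real m) * (2 * \<eta> / L * err S s) \<le> \<theta> (Suc s) * (2 * \<eta> / L * err S s)"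
        "\<theta> (Suc s) * (2 * \<eta>\<^sup>2 + 2 * \<eta> * \<xi>) \<le> 1 / (4 * \<eta>\<^sup>2 * real m) * (2 * \<eta>\<^sup>2 + 2 * \<eta> * \<xi>)"
        by (auto intro!: mult_right_mono simp del: times_divide_eq_left)
      then show "1 / (8 * \<eta>\<^sup>2 * real m) * (2 * \<eta> / L * err S s) - 1 / (4 * \<eta>\<^sup>2 * real m) * (2 * \<eta>\<^sup>2 + 2 * \<eta> * \<xi>)
         \<le> \<theta> (Suc s) * (2 * \<eta> / L * err S s - (2 * \<eta>\<^sup>2 + 2 * \<eta> * \<xi>))"
        unfolding right_diff_distrib by linarith
    qed
    moreover have "(\<Sum>s<m. 1 / (8 * \<eta>\<^sup>2 * real m) * (2 * \<eta> / L * err S s) - 1 / (4 * \<eta>\<^sup>2 * real m) * (2 * \<eta>\<^sup>2 + 2 * \<eta> * \<xi>))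
        = E S / (4 * \<eta> * L) - (\<eta> + \<xi>) / (2 * \<eta>)"
      unfolding sum_subtractf sum_distrib_left[symmetric] E_def using m \<eta>_pos L_pos
      by (simp add: field_simps power2_eq_square)
    ultimately show ?thesis unfolding Y_def by linarith
  qed
  define c where "c = exp (- (\<theta> 0 * V + ln (1 / \<delta>)))"
  have bad: "1 \<le> c * exp (Y S)" if "S \<in> space (sample_measure m)" "\<not> E S \<le> B" for S
  proof -
    have "B / (4 * \<eta> * L) - (\<eta> + \<xi>) / (2 * \<eta>) \<le> E S / (4 * \<eta> * L) - (\<eta> + \<xi>) / (2 * \<eta>)"
      using that \<eta>_pos L_pos by (intro diff_right_mono divide_right_mono) auto
    also note lower[OF that(1)]
    also have "B / (4 * \<eta> * L) - (\<eta> + \<xi>) / (2 * \<eta>) = \<theta> 0 * V + ln (1 / \<delta>)"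
      using m \<eta>_pos L_pos by (simp add: B_def \<theta>_def field_simps power2_eq_square)
    finally have "0 \<le> - (\<theta> 0 * V + ln (1 / \<delta>)) + Y S" by linarith
    then show ?thesis by (simp add: c_def exp_add[symmetric])
  qed
  have "emeasure (sample_measure m) {S \<in> space (sample_measure m). \<not> E S \<le> B}
     \<le> emeasure (sample_measure m) {S \<in> space (sample_measure m). 1 \<le> ennreal c * ennreal (exp (Y S))}"
    using bad by (intro emeasure_mono) (auto simp: c_def ennreal_mult'[symmetric])
  also have "\<dots> \<le> ennreal c * (\<integral>\<^sup>+S. ennreal (exp (Y S)) * indicator (space (sample_measure m)) S \<partial>sample_measure m)"
    by (rule nn_integral_Markov_inequality) auto
  also have "(\<integral>\<^sup>+S. ennreal (exp (Y S)) * indicator (space (sample_measure m)) S \<partial>sample_measure m)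
     = (\<integral>\<^sup>+S. ennreal (exp (Y S)) \<partial>sample_measure m)"
    by (intro nn_integral_cong) simp
  also have "ennreal c * \<dots> \<le> ennreal c * ennreal (exp (\<theta> 0 * V))"
    by (intro mult_left_mono Y_le) simp
  also have "\<dots> = ennreal \<delta>"
    using \<delta> by (simp add: c_def ennreal_mult'[symmetric] exp_add[symmetric] ln_div)
  finally have "S.prob {S \<in> space (sample_measure m). \<not> E S \<le> B} \<le> \<delta>"
    using \<delta> by (simp add: S.emeasure_eq_measure)
  moreover have "S.prob {S \<in> space (sample_measure m). \<not> E S \<le> B} = 1 - S.prob {S \<in> space (sample_measure m). E S \<le> B}"
    by (rule S.prob_neg) measurable
  ultimately show ?thesis by (simp add: E_def B_def)
qed

end

section \<open>The programs\<close>

text \<open>A total-correctness triple with a time bound. The postcondition may itself be a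
  \<open>runs\<close> statement about the rest of the program, which is how sequences are
  composed.\<close>

definition runs :: "(real \<Rightarrow> real) \<Rightarrow> com \<Rightarrow> state \<Rightarrow> nat \<Rightarrow> (state \<Rightarrow> bool) \<Rightarrow> bool" where
  "runs u p s T Q \<longleftrightarrow> (\<exists>t s'. exec u p s t s' \<and> t \<le> T \<and> Q s')"

lemma runs_mono:
  "runs u p s T Q \<Longrightarrow> T \<le> T' \<Longrightarrow> (\<And>s'. Q s' \<Longrightarrow> Q' s') \<Longrightarrow> runs u p s T' Q'"
  unfolding runs_def by (meson order_trans)

lemma runs_Skip: "Q s \<Longrightarrow> runs u Skip s 1 Q"
  unfolding runs_def by (blast intro: exec.Skip)

lemma runs_SetReg: "Q ((fst s)(r := ival s e), snd s) \<Longrightarrow> runs u (SetReg r e) s (icost e + 1) Q"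
  unfolding runs_def by (blast intro: exec.SetReg)

lemma runs_Store:
  "Q (fst s, (snd s)(A := (snd s A)(ival s e := rval u s f))) \<Longrightarrow>
    runs u (Store A e f) s (icost e + rcost f + 1) Q"
  unfolding runs_def by (blast intro: exec.Store)

lemma runs_Seq:
  "runs u p s T (\<lambda>s'. runs u q s' T' Q) \<Longrightarrow> runs u (Seq p q) s (T + T') Q"
  unfolding runs_def by (blast intro: exec.Seq add_mono)

lemma runs_Cond:
  assumes "bval u s b \<Longrightarrow> runs u p s T Q" "\<not> bval u s b \<Longrightarrow> runs u q s T Q"
  shows "runs u (Cond b p q) s (bcost b + T) Q"
  using assms unfolding runs_def by (meson add_left_mono exec.CondFalse exec.CondTrue)

lemma runs_While:
  assumes "I 0 s" and step: "\<And>i s. i < N \<Longrightarrow> I i s \<Longrightarrow> bval u s b \<and> runs u p s T (I (Suc i))"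
    and exit: "\<And>s. I N s \<Longrightarrow> \<not> bval u s b"
  shows "runs u (While b p) s (N * (bcost b + T) + bcost b) (I N)"
proof -
  have "runs u (While b p) s ((N - i) * (bcost b + T) + bcost b) (I N)" if "i \<le> N" "I i s" for i s
    using that
  proof (induction "N - i" arbitrary: i s)
    case 0
    then have "I N s" by simp
    then show ?case
      unfolding runs_def using exec.WhileFalse[OF exit] by fastforce
  next
    case (Suc d)
    then have i: "i < N" "d = N - Suc i" "Suc i \<le> N" by auto
    from step[OF i(1) Suc.prems(2)] obtain t s' where
      b: "bval u s b" and s': "exec u p s t s'" "t \<le> T" "I (Suc i) s'"
      unfolding runs_def by blast
    from Suc.hyps(1)[OF i(2,3) s'(3)] obtain t' s'' where
      s'': "exec u (While b p) s' t' s''" "t' \<le> (N - Suc i) * (bcost b + T) + bcost b" "I N s''"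
      unfolding runs_def by blast
    have "N - i = Suc (N - Suc i)" using i by simp
    then have "bcost b + t + t' \<le> (N - i) * (bcost b + T) + bcost b"
      using s'(2) s''(2) by simp
    then show ?case
      unfolding runs_def using exec.WhileTrue[OF b s'(1) s''(1)] s''(3) by blast
  qed
  from this[of 0 s] show ?thesis using assms(1) by simp
qed

definition For :: "nat \<Rightarrow> iexp \<Rightarrow> com \<Rightarrow> com" where
  "For r e p = Seq (SetReg r (ICon 0))
     (While (ILess (IReg r) e) (Seq p (SetReg r (IAdd (IReg r) (ICon 1)))))"

text \<open>The bound \<open>e\<close> is evaluated anew at every test, so the invariant must
  preserve its value \<open>N\<close>. Each round pays \<open>icost e + 2\<close> for the test and 4
  for the increment.\<close>

lemma runs_For:
  assumes "I 0 ((fst s)(r := 0), snd s)"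
    and I: "\<And>i s. I i s \<Longrightarrow> fst s r = i \<and> ival s e = N"
    and step: "\<And>i s. i < N \<Longrightarrow> I i s \<Longrightarrow>
      runs u p s T (\<lambda>s'. fst s' r = i \<and> I (Suc i) ((fst s')(r := Suc i), snd s'))"
  shows "runs u (For r e p) s (N * (icost e + T + 6) + icost e + 4) (I N)"
proof -
  have "runs u (While (ILess (IReg r) e) (Seq p (SetReg r (IAdd (IReg r) (ICon 1)))))
     ((fst s)(r := 0), snd s)
     (N * (bcost (ILess (IReg r) e) + (T + (icost (IAdd (IReg r) (ICon 1)) + 1)))
       + bcost (ILess (IReg r) e)) (I N)"
  proof (rule runs_While)
    fix i s assume i: "i < N" "I i s"
    have "runs u (Seq p (SetReg r (IAdd (IReg r) (ICon 1)))) s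
       (T + (icost (IAdd (IReg r) (ICon 1)) + 1)) (I (Suc i))"
      by (rule runs_Seq, rule runs_mono[OF step[OF i] order_refl], rule runs_SetReg) simp
    with i show "bval u s (ILess (IReg r) e) \<and> runs u (Seq p (SetReg r (IAdd (IReg r) (ICon 1)))) s
       (T + (icost (IAdd (IReg r) (ICon 1)) + 1)) (I (Suc i))"
      using I[OF i(2)] by simp
  next
    fix s assume "I N s"
    then show "\<not> bval u s (ILess (IReg r) e)" using I[of N s] by simp
  qed (rule assms(1))
  then have "runs u (SetReg r (ICon 0)) s (icost (ICon 0) + 1)
     (\<lambda>s'. runs u (While (ILess (IReg r) e) (Seq p (SetReg r (IAdd (IReg r) (ICon 1))))) s'
     (N * (bcost (ILess (IReg r) e) + (T + (icost (IAdd (IReg r) (ICon 1)) + 1)))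
       + bcost (ILess (IReg r) e)) (I N))"
    by (intro runs_SetReg) simp
  from runs_Seq[OF this] show ?thesis
    unfolding For_def by (rule runs_mono) (auto simp: algebra_simps)
qed

section \<open>Inner products and kernel expansions as programs\<close>

definition same_outside :: "nat set \<Rightarrow> nat set \<Rightarrow> state \<Rightarrow> state \<Rightarrow> bool" where
  "same_outside R A s s' \<longleftrightarrow> (\<forall>r. r \<notin> R \<longrightarrow> fst s' r = fst s r) \<and> (\<forall>B. B \<notin> A \<longrightarrow> snd s' B = snd s B)"

text \<open>Register 3 holds the index of a sample point. The other point of the inner product starts at
  address \<open>off\<close> of array \<open>A\<close>. Result in array 8.\<close>

definition dot_prog :: "nat \<Rightarrow> iexp \<Rightarrow> com" where
  "dot_prog A off = Seq (Store 8 (ICon 0) (OfNat (ICon 0)))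
     (For 4 (IReg 0) (Store 8 (ICon 0) (RAdd (Cell 8 (ICon 0))
        (RMul (Cell 1 (IAdd (IMul (IReg 3) (IReg 0)) (IReg 4))) (Cell A (IAdd off (IReg 4)))))))"

lemma runs_dot_prog:
  assumes A: "A \<noteq> 8" and off: "\<And>s'. same_outside {4} {8} s s' \<Longrightarrow> ival s' off = o'"
    and cost: "icost off \<le> 3"
  shows "runs u (dot_prog A off) s (25 * fst s 0 + 9) (\<lambda>s'. same_outside {4} {8} s s' \<and>
     snd s' 8 0 = (\<Sum>j<fst s 0. snd s 1 (fst s 3 * fst s 0 + j) * snd s A (o' + j)))"
proof -
  define s1 where "s1 = (fst s, (snd s)(8 := (snd s 8)(0 := 0)))"
  define I where "I = (\<lambda>i s'. same_outside {4} {8} s s' \<and> fst s' 4 = i \<and>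
     snd s' 8 0 = (\<Sum>j<i. snd s 1 (fst s 3 * fst s 0 + j) * snd s A (o' + j)))"
  define body where "body = Store 8 (ICon 0) (RAdd (Cell 8 (ICon 0))
        (RMul (Cell 1 (IAdd (IMul (IReg 3) (IReg 0)) (IReg 4))) (Cell A (IAdd off (IReg 4)))))"
  have "runs u (For 4 (IReg 0) body) s1 (fst s 0 * (icost (IReg 0) + 18 + 6) + icost (IReg 0) + 4) (I (fst s 0))"
  proof (rule runs_For)
    show "I 0 ((fst s1)(4 := 0), snd s1)"
      by (simp add: I_def s1_def same_outside_def)
    show "fst s' 4 = i \<and> ival s' (IReg 0) = fst s 0" if "I i s'" for i s'
      using that by (simp add: I_def same_outside_def)
    fix i s' assume i: "i < fst s 0" "I i s'"
    then have eq: "fst s' 4 = i" "fst s' 0 = fst s 0" "fst s' 3 = fst s 3" "snd s' 1 = snd s 1"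
      "snd s' A = snd s A" "ival s' off = o'"
      using A off by (auto simp: I_def same_outside_def)
    show "runs u body s' 18 (\<lambda>s'. fst s' 4 = i \<and> I (Suc i) ((fst s')(4 := Suc i), snd s'))"
      unfolding body_def
      by (rule runs_mono[OF runs_Store[where Q = "\<lambda>s'. fst s' 4 = i \<and> I (Suc i) ((fst s')(4 := Suc i), snd s')"]])
         (use i cost in \<open>simp_all add: eq, simp_all add: I_def same_outside_def\<close>)
  qed
  then have "runs u (Store 8 (ICon 0) (OfNat (ICon 0))) s (icost (ICon 0) + rcost (OfNat (ICon 0)) + 1)
     (\<lambda>s'. runs u (For 4 (IReg 0) body) s' (fst s 0 * (icost (IReg 0) + 18 + 6) + icost (IReg 0) + 4) (I (fst s 0)))"
    by (intro runs_Store) (simp add: s1_def)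
  from runs_Seq[OF this] show ?thesis
    unfolding dot_prog_def body_def by (rule runs_mono) (auto simp: I_def)
qed

text \<open>Array 5 holds the coefficients of the kernel expansion. The value of the expansion of length
  \<open>e\<close> is left in array 6, and the sum of the activations of all shorter expansions in array 4.\<close>

definition score_prog :: "nat \<Rightarrow> iexp \<Rightarrow> iexp \<Rightarrow> com" where
  "score_prog A off e = Seq (Store 6 (ICon 0) (OfNat (ICon 0))) (Seq (Store 4 (ICon 0) (OfNat (ICon 0)))
     (For 3 e (Seq (Store 4 (ICon 0) (RAdd (Cell 4 (ICon 0)) (Act (Cell 6 (ICon 0)))))
       (Seq (dot_prog A off)
         (Store 6 (ICon 0) (RAdd (Cell 6 (ICon 0)) (RMul (Cell 5 (IReg 3))
           (RDiv (OfNat (ICon 2)) (RSub (OfNat (ICon 2)) (Cell 8 (ICon 0)))))))))))"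

definition expansion :: "state \<Rightarrow> nat \<Rightarrow> nat \<Rightarrow> nat \<Rightarrow> real" where
  "expansion s A o' t = (\<Sum>i<t. snd s 5 i *
     kernel (\<Sum>j<fst s 0. snd s 1 (i * fst s 0 + j) * snd s A (o' + j)))"

lemma runs_score_prog:
  assumes A: "A \<notin> {4, 6, 8}"
    and off: "\<And>s'. same_outside {3, 4} {4, 6, 8} s s' \<Longrightarrow> ival s' off = o'" "icost off \<le> 3"
    and e: "\<And>s'. same_outside {3, 4} {4, 6, 8} s s' \<Longrightarrow> ival s' e = N" "icost e = 1"
  shows "runs u (score_prog A off e) s (N * (25 * fst s 0 + 40) + 13)
    (\<lambda>s'. same_outside {3, 4} {4, 6, 8} s s' \<and> snd s' 6 0 = expansion s A o' N \<and>
      snd s' 4 0 = (\<Sum>t<N. u (expansion s A o' t)))"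
proof -
  define I where "I = (\<lambda>i s'. same_outside {3, 4} {4, 6, 8} s s' \<and> fst s' 3 = i \<and>
     snd s' 6 0 = expansion s A o' i \<and> snd s' 4 0 = (\<Sum>t<i. u (expansion s A o' t)))"
  \<comment> \<open>The activation is added before the expansion grows, so round \<open>i\<close>
    contributes the prediction of the expansion of length \<open>i\<close>, starting with the empty
    one, as in \<open>hypothesis\<close>.\<close>
  define b1 where "b1 = Store 4 (ICon 0) (RAdd (Cell 4 (ICon 0)) (Act (Cell 6 (ICon 0))))"
  define b3 where "b3 = Store 6 (ICon 0) (RAdd (Cell 6 (ICon 0)) (RMul (Cell 5 (IReg 3))
           (RDiv (OfNat (ICon 2)) (RSub (OfNat (ICon 2)) (Cell 8 (ICon 0))))))"
  define body where "body = Seq b1 (Seq (dot_prog A off) b3)"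
  define s1 where "s1 = (fst s, (snd s)(6 := (snd s 6)(0 := 0), 4 := (snd s 4)(0 := 0)))"
  have For: "runs u (For 3 e body) s1 (N * (icost e + (8 + ((25 * fst s 0 + 9) + 16)) + 6) + icost e + 4) (I N)"
  proof (rule runs_For)
    show "I 0 ((fst s1)(3 := 0), snd s1)"
      by (simp add: I_def s1_def same_outside_def expansion_def)
    show "fst s' 3 = i \<and> ival s' e = N" if "I i s'" for i s'
      using that e by (simp add: I_def)
    fix i s' assume i: "i < N" "I i s'"
    define s2 where "s2 = (fst s', (snd s')(4 := (snd s' 4)(0 := snd s' 4 0 + u (snd s' 6 0))))"
    have s2: "same_outside {3, 4} {4, 6, 8} s s2" "fst s2 3 = i" "fst s2 0 = fst s 0"
        "snd s2 1 = snd s 1" "snd s2 5 = snd s 5" "snd s2 A = snd s A"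
        "snd s2 6 0 = expansion s A o' i" "snd s2 4 0 = (\<Sum>t<Suc i. u (expansion s A o' t))"
      using i A by (auto simp: s2_def I_def same_outside_def)
    have "runs u (dot_prog A off) s2 (25 * fst s2 0 + 9) (\<lambda>s'. same_outside {4} {8} s2 s' \<and>
       snd s' 8 0 = (\<Sum>j<fst s2 0. snd s2 1 (fst s2 3 * fst s2 0 + j) * snd s2 A (o' + j)))"
      using A s2(1) off by (intro runs_dot_prog) (auto simp: same_outside_def)
    then have "runs u (dot_prog A off) s2 (25 * fst s 0 + 9)
      (\<lambda>s'. runs u b3 s' 16 (\<lambda>s'. fst s' 3 = i \<and> I (Suc i) ((fst s')(3 := Suc i), snd s')))"
    proof (rule runs_mono)
      fix s3 assume s3: "same_outside {4} {8} s2 s3 \<and>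
       snd s3 8 0 = (\<Sum>j<fst s2 0. snd s2 1 (fst s2 3 * fst s2 0 + j) * snd s2 A (o' + j))"
      then have s3': "fst s3 3 = i" "snd s3 5 = snd s 5" "snd s3 6 0 = expansion s A o' i"
        "snd s3 4 0 = (\<Sum>t<Suc i. u (expansion s A o' t))" "same_outside {3, 4} {4, 6, 8} s s3"
        "snd s3 8 0 = (\<Sum>j<fst s 0. snd s 1 (i * fst s 0 + j) * snd s A (o' + j))"
        using s2 by (auto simp: same_outside_def)
      have "expansion s A o' (Suc i) = expansion s A o' i + snd s 5 i * (2 / (2 - snd s3 8 0))"
        by (simp add: expansion_def kernel_def s3'(6))
      then show "runs u b3 s3 16 (\<lambda>s'. fst s' 3 = i \<and> I (Suc i) ((fst s')(3 := Suc i), snd s'))"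
        unfolding b3_def
        by (intro runs_mono[OF runs_Store[where Q = "\<lambda>s'. fst s' 3 = i \<and> I (Suc i) ((fst s')(3 := Suc i), snd s')"]])
           (use s3'(1-5) in \<open>simp_all add: I_def same_outside_def\<close>)
    qed (simp add: s2)
    from runs_Seq[OF this]
    have "runs u b1 s' 8 (\<lambda>s2. runs u (Seq (dot_prog A off) b3) s2 ((25 * fst s 0 + 9) + 16)
        (\<lambda>s'. fst s' 3 = i \<and> I (Suc i) ((fst s')(3 := Suc i), snd s')))"
      unfolding b1_def
      by (intro runs_mono[OF runs_Store[where Q = "\<lambda>s2. runs u (Seq (dot_prog A off) b3) s2 ((25 * fst s 0 + 9) + 16)
        (\<lambda>s'. fst s' 3 = i \<and> I (Suc i) ((fst s')(3 := Suc i), snd s'))"]]) (simp_all add: s2_def)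
    from runs_Seq[OF this]
    show "runs u body s' (8 + ((25 * fst s 0 + 9) + 16)) (\<lambda>s'. fst s' 3 = i \<and> I (Suc i) ((fst s')(3 := Suc i), snd s'))"
      by (simp add: body_def)
  qed
  have "runs u (Store 4 (ICon 0) (OfNat (ICon 0))) (fst s, (snd s)(6 := (snd s 6)(0 := 0))) 4
    (\<lambda>s'. runs u (For 3 e body) s' (N * (icost e + (8 + ((25 * fst s 0 + 9) + 16)) + 6) + icost e + 4) (I N))"
    by (rule runs_mono[OF runs_Store[where Q = "\<lambda>s'. runs u (For 3 e body) s'
         (N * (icost e + (8 + ((25 * fst s 0 + 9) + 16)) + 6) + icost e + 4) (I N)"]])
       (use For in \<open>simp_all add: s1_def\<close>)
  from runs_Seq[OF this]
  have "runs u (Store 6 (ICon 0) (OfNat (ICon 0))) s 4 (\<lambda>s'. runs u (Seq (Store 4 (ICon 0) (OfNat (ICon 0))) (For 3 e body)) s'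
     (4 + (N * (icost e + (8 + ((25 * fst s 0 + 9) + 16)) + 6) + icost e + 4)) (I N))"
    by (intro runs_mono[OF runs_Store[where Q = "\<lambda>s'. runs u (Seq (Store 4 (ICon 0) (OfNat (ICon 0))) (For 3 e body)) s'
     (4 + (N * (icost e + (8 + ((25 * fst s 0 + 9) + 16)) + 6) + icost e + 4)) (I N)"]]) simp_all
  from runs_Seq[OF this] show ?thesis
    unfolding score_prog_def body_def b1_def b3_def
    by (rule runs_mono) (use e in \<open>auto simp: I_def algebra_simps\<close>)
qed

text \<open>An integer substitute for the logarithm of \<open>1 / \<delta>\<close>: programs have no
  logarithm, but they can double \<open>\<delta>\<close> and count.\<close>

definition rounds :: "real \<Rightarrow> nat" where
  "rounds \<delta> = max 1 (nat \<lceil>log 2 (1 / \<delta>)\<rceil>)"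

text \<open>The denominator is chosen to make the deviation term
  \<open>4 * \<eta> * L * ln (1 / \<delta>)\<close> at most \<open>\<epsilon> / 4\<close>.\<close>

definition rate :: "nat \<Rightarrow> real \<Rightarrow> real \<Rightarrow> real \<Rightarrow> real" where
  "rate k L \<epsilon> \<delta> = (if \<epsilon> < real k * L then \<epsilon> / (16 * L * real (rounds \<delta>)) else 0)"

text \<open>The left-hand side is the loop test by which \<open>rate_prog\<close> finds
  \<open>rounds \<delta>\<close>; the search starts at \<open>j = 1\<close> because of the maximum
  in \<open>rounds\<close>.\<close>

lemma less_rounds_iff:
  assumes "\<delta> > 0" "j \<ge> 1"
  shows "2 ^ j * \<delta> < 1 \<longleftrightarrow> j < rounds \<delta>"
proof -
  have "2 ^ j * \<delta> < 1 \<longleftrightarrow> 2 powr real j < 1 / \<delta>"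
    using assms by (simp add: powr_realpow field_simps)
  also have "\<dots> \<longleftrightarrow> real j < log 2 (1 / \<delta>)"
    using assms by (subst less_log_iff) auto
  also have "\<dots> \<longleftrightarrow> int j < \<lceil>log 2 (1 / \<delta>)\<rceil>"
    by (simp add: less_ceiling_iff)
  also have "\<dots> \<longleftrightarrow> j < rounds \<delta>"
    using assms by (auto simp: rounds_def)
  finally show ?thesis .
qed

text \<open>Register 6 holds the candidate \<open>j\<close> for \<open>rounds \<delta>\<close> and array 10 the value \<open>2 ^ j * \<delta>\<close>. The rate
  is left in array 9, whose initial value 0 is already the rate of the second case.\<close>

definition rate_prog :: com where
  "rate_prog = Seq (SetReg 6 (ICon 1)) (Seq (Store 10 (ICon 0) (RMul (OfNat (ICon 2)) (Cell 0 (ICon 2))))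
     (Seq (While (RLess (Cell 10 (ICon 0)) (OfNat (ICon 1)))
         (Seq (SetReg 6 (IAdd (IReg 6) (ICon 1)))
           (Store 10 (ICon 0) (RMul (OfNat (ICon 2)) (Cell 10 (ICon 0))))))
       (Cond (RLess (Cell 0 (ICon 1)) (RMul (OfNat (IReg 2)) (Cell 0 (ICon 0))))
         (Store 9 (ICon 0) (RDiv (Cell 0 (ICon 1))
           (RMul (RMul (OfNat (ICon 16)) (Cell 0 (ICon 0))) (OfNat (IReg 6)))))
         Skip)))"

lemma runs_rate_prog:
  assumes \<delta>: "snd s 0 2 > 0" and zero: "snd s 9 0 = 0"
  shows "runs u rate_prog s (16 * rounds (snd s 0 2) + 35) (\<lambda>s'. same_outside {6} {9, 10} s s' \<and>
    snd s' 9 0 = rate (fst s 2) (snd s 0 0) (snd s 0 1) (snd s 0 2))"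
proof -
  define \<delta> where "\<delta> = snd s 0 2"
  \<comment> \<open>The candidate starts at 1, so the loop runs once less than
    \<open>rounds \<delta>\<close>, and after \<open>i\<close> iterations the candidate is
    \<open>Suc i\<close>.\<close>
  define N where "N = rounds \<delta> - 1"
  have \<delta>_pos: "\<delta> > 0" using \<delta> by (simp add: \<delta>_def)
  have N: "Suc N = rounds \<delta>" by (simp add: N_def rounds_def)
  define I where "I = (\<lambda>i s'. same_outside {6} {10} s s' \<and> fst s' 6 = Suc i \<and> snd s' 10 0 = 2 ^ Suc i * \<delta>)"
  define Q where "Q = (\<lambda>s'. same_outside {6} {9, 10} s s' \<and>
    snd s' 9 0 = rate (fst s 2) (snd s 0 0) (snd s 0 1) \<delta>)"
  define g where "g = RLess (Cell 10 (ICon 0)) (OfNat (ICon 1))"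
  define body where "body = Seq (SetReg 6 (IAdd (IReg 6) (ICon 1)))
           (Store 10 (ICon 0) (RMul (OfNat (ICon 2)) (Cell 10 (ICon 0))))"
  define fin where "fin = Cond (RLess (Cell 0 (ICon 1)) (RMul (OfNat (IReg 2)) (Cell 0 (ICon 0))))
         (Store 9 (ICon 0) (RDiv (Cell 0 (ICon 1))
           (RMul (RMul (OfNat (ICon 16)) (Cell 0 (ICon 0))) (OfNat (IReg 6)))))
         Skip"
  define s1 where "s1 = ((fst s)(6 := 1), snd s)"
  define s2 where "s2 = ((fst s)(6 := 1), (snd s)(10 := (snd s 10)(0 := 2 * \<delta>)))"
  have fin: "runs u fin s' 21 Q" if "I N s'" for s'
  proof -
    from that have eq: "snd s' 0 = snd s 0" "fst s' 2 = fst s 2" "snd s' 9 0 = 0" "fst s' 6 = rounds \<delta>"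
      using zero N by (auto simp: I_def same_outside_def)
    have "runs u fin s' (bcost (RLess (Cell 0 (ICon 1)) (RMul (OfNat (IReg 2)) (Cell 0 (ICon 0)))) + 13) Q"
      unfolding fin_def
    proof (rule runs_Cond)
      assume "bval u s' (RLess (Cell 0 (ICon 1)) (RMul (OfNat (IReg 2)) (Cell 0 (ICon 0))))"
      then have b: "snd s 0 1 < real (fst s 2) * snd s 0 0" by (simp add: eq)
      show "runs u (Store 9 (ICon 0) (RDiv (Cell 0 (ICon 1))
           (RMul (RMul (OfNat (ICon 16)) (Cell 0 (ICon 0))) (OfNat (IReg 6))))) s' 13 Q"
        by (rule runs_mono[OF runs_Store[where Q = Q]])
           (use that b in \<open>auto simp: Q_def I_def same_outside_def rate_def eq N\<close>)
    next
      assume "\<not> bval u s' (RLess (Cell 0 (ICon 1)) (RMul (OfNat (IReg 2)) (Cell 0 (ICon 0))))"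
      then have b: "\<not> snd s 0 1 < real (fst s 2) * snd s 0 0" by (simp add: eq)
      show "runs u Skip s' 13 Q"
        by (rule runs_mono[OF runs_Skip[where Q = Q]])
           (use that b zero in \<open>auto simp: Q_def I_def same_outside_def rate_def eq\<close>)
    qed
    then show ?thesis by simp
  qed
  have "runs u (While g body) s2 (N * (bcost g + 11) + bcost g) (I N)"
  proof (rule runs_While)
    show "I 0 s2" by (simp add: I_def s2_def same_outside_def)
    show "\<not> bval u s' g" if "I N s'" for s'
      using that less_rounds_iff[of \<delta> "Suc N"] \<delta>_pos by (simp add: I_def g_def N[symmetric])
    fix i s' assume i: "i < N" "I i s'"
    have "runs u (SetReg 6 (IAdd (IReg 6) (ICon 1))) s' 4
      (\<lambda>s'. runs u (Store 10 (ICon 0) (RMul (OfNat (ICon 2)) (Cell 10 (ICon 0)))) s' 7 (I (Suc i)))"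
      by (rule runs_mono[OF runs_SetReg[where Q = "\<lambda>s'. runs u (Store 10 (ICon 0) (RMul (OfNat (ICon 2)) (Cell 10 (ICon 0)))) s' 7 (I (Suc i))"]],
          rule runs_mono[OF runs_Store[where Q = "I (Suc i)"]])
         (use i in \<open>auto simp: I_def same_outside_def\<close>)
    from runs_Seq[OF this] show "bval u s' g \<and> runs u body s' 11 (I (Suc i))"
      using i less_rounds_iff[of \<delta> "Suc i"] \<delta>_pos by (auto simp: I_def g_def body_def N[symmetric])
  qed
  then have "runs u (While g body) s2 (16 * N + 5) (\<lambda>s'. runs u fin s' 21 Q)"
    by (rule runs_mono) (auto simp: g_def intro: fin)
  from runs_Seq[OF this]
  have "runs u (Store 10 (ICon 0) (RMul (OfNat (ICon 2)) (Cell 0 (ICon 2)))) s1 7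
     (\<lambda>s'. runs u (Seq (While g body) fin) s' (16 * N + 5 + 21) Q)"
    by (intro runs_mono[OF runs_Store[where Q = "\<lambda>s'. runs u (Seq (While g body) fin) s' (16 * N + 5 + 21) Q"]])
       (simp_all add: s1_def s2_def \<delta>_def)
  from runs_Seq[OF this]
  have "runs u (SetReg 6 (ICon 1)) s 2 (\<lambda>s'. runs u (Seq (Store 10 (ICon 0) (RMul (OfNat (ICon 2)) (Cell 0 (ICon 2))))
     (Seq (While g body) fin)) s' (7 + (16 * N + 5 + 21)) Q)"
    by (intro runs_mono[OF runs_SetReg[where Q = "\<lambda>s'. runs u (Seq (Store 10 (ICon 0) (RMul (OfNat (ICon 2)) (Cell 0 (ICon 2))))
     (Seq (While g body) fin)) s' (7 + (16 * N + 5 + 21)) Q"]]) (simp_all add: s1_def)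
  from runs_Seq[OF this] show ?thesis
    unfolding rate_prog_def g_def body_def fin_def
    by (rule runs_mono) (use N in \<open>auto simp: Q_def \<delta>_def\<close>)
qed

text \<open>Registers 3 and 4 are used by \<open>score_prog\<close> and register 6 by \<open>rate_prog\<close>.\<close>

definition learner_prog :: com where
  "learner_prog = Seq rate_prog (For 5 (IReg 1)
     (Seq (score_prog 1 (IMul (IReg 5) (IReg 0)) (IReg 5))
       (Store 5 (IReg 5) (RMul (Cell 9 (ICon 0)) (RSub (Cell 2 (IReg 5)) (Act (Cell 6 (ICon 0))))))))"

definition evaluator_prog :: com where
  "evaluator_prog = Seq (score_prog 3 (ICon 0) (IReg 1))
     (Store 4 (ICon 0) (RDiv (Cell 4 (ICon 0)) (OfNat (IReg 1))))"

text \<open>The simulation relation between memory and iterates; \<open>t\<close> counts the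
  coefficients already stored.\<close>

definition trained ::
    "nat \<Rightarrow> nat \<Rightarrow> (real \<Rightarrow> real) \<Rightarrow> real \<Rightarrow> (nat \<Rightarrow> (nat \<Rightarrow> real) \<times> real) \<Rightarrow> nat \<Rightarrow> state \<Rightarrow> bool" where
  "trained n m u \<eta> S t s \<longleftrightarrow> fst s 0 = n \<and> fst s 1 = m \<and> snd s 9 0 = \<eta> \<and>
     (\<forall>i<m. \<forall>j<n. snd s 1 (i * n + j) = fst (S i) j) \<and> (\<forall>i<m. snd s 2 i = snd (S i)) \<and>
     (\<forall>i<t. snd s 5 i = \<eta> * residual n u \<eta> S i)"

lemma expansion_eq_score:
  assumes s: "trained n m u \<eta> S t s" and x: "\<And>j. j < n \<Longrightarrow> snd s A (o' + j) = x j"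
    and i: "i \<le> t" "i \<le> m"
  shows "expansion s A o' i = score n u \<eta> S i x"
proof -
  have "snd s 5 l * kernel (\<Sum>j<fst s 0. snd s 1 (l * fst s 0 + j) * snd s A (o' + j))
      = \<eta> * residual n u \<eta> S l * kernel (ip n (fst (S l)) x)" if "l < i" for l
    using s x i that by (simp add: trained_def ip_def)
  then show ?thesis
    by (simp add: expansion_def score_eq_sum)
qed

text \<open>The time of the doubling loop depends on \<open>\<delta>\<close>; the assumption
  \<open>rounds \<delta> \<le> m\<close> turns it into a bound in \<open>m\<close>. The quadratic
  dependence on \<open>m\<close> stems from evaluating iterate \<open>t\<close> by \<open>t\<close>
  kernel terms in each round.\<close>

lemma runs_learner_prog:
  fixes S :: "nat \<Rightarrow> (nat \<Rightarrow> real) \<times> real"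
  assumes \<delta>: "\<delta> > 0" and rounds: "rounds \<delta> \<le> m"
  shows "runs u learner_prog (input_state n m k L \<epsilon> \<delta> S) (m * (m * (25 * n + 40) + 47) + 40)
    (trained n m u (rate k L \<epsilon> \<delta>) S m)"
proof -
  define \<eta> where "\<eta> = rate k L \<epsilon> \<delta>"
  define s0 where "s0 = input_state n m k L \<epsilon> \<delta> S"
  define body where "body = Seq (score_prog 1 (IMul (IReg 5) (IReg 0)) (IReg 5))
       (Store 5 (IReg 5) (RMul (Cell 9 (ICon 0)) (RSub (Cell 2 (IReg 5)) (Act (Cell 6 (ICon 0))))))"
  define I where "I = (\<lambda>t s. trained n m u \<eta> S t s \<and> fst s 5 = t)"
  define T where "T = m * (25 * n + 40) + 24"
  have For: "runs u (For 5 (IReg 1) body) s (m * (icost (IReg 1) + T + 6) + icost (IReg 1) + 4) (I m)"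
    if "trained n m u \<eta> S 0 s" for s
  proof (rule runs_For)
    show "I 0 ((fst s)(5 := 0), snd s)"
      using that by (simp add: I_def trained_def)
    show "fst s 5 = t \<and> ival s (IReg 1) = m" if "I t s" for t s
      using that by (simp add: I_def trained_def)
    fix t s assume t: "t < m" "I t s"
    then have s: "trained n m u \<eta> S t s" "fst s 5 = t" "fst s 0 = n" by (auto simp: I_def trained_def)
    have point: "snd s 1 (t * n + j) = fst (S t) j" if "j < n" for j
      using s(1) t(1) that by (simp add: trained_def)
    have "runs u (score_prog 1 (IMul (IReg 5) (IReg 0)) (IReg 5)) s (t * (25 * fst s 0 + 40) + 13)
      (\<lambda>s'. same_outside {3, 4} {4, 6, 8} s s' \<and> snd s' 6 0 = expansion s 1 (t * n) t \<and>
        snd s' 4 0 = (\<Sum>i<t. u (expansion s 1 (t * n) i)))"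
      by (rule runs_score_prog) (use s in \<open>auto simp: same_outside_def\<close>)
    then have "runs u (score_prog 1 (IMul (IReg 5) (IReg 0)) (IReg 5)) s (m * (25 * n + 40) + 13)
      (\<lambda>s'. runs u (Store 5 (IReg 5) (RMul (Cell 9 (ICon 0)) (RSub (Cell 2 (IReg 5)) (Act (Cell 6 (ICon 0)))))) s' 11
        (\<lambda>s'. fst s' 5 = t \<and> I (Suc t) ((fst s')(5 := Suc t), snd s')))"
    proof (rule runs_mono)
      show "t * (25 * fst s 0 + 40) + 13 \<le> m * (25 * n + 40) + 13"
        using t s by (intro add_mono mult_mono) auto
      fix s' assume s': "same_outside {3, 4} {4, 6, 8} s s' \<and> snd s' 6 0 = expansion s 1 (t * n) t \<and>
        snd s' 4 0 = (\<Sum>i<t. u (expansion s 1 (t * n) i))"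
      have "expansion s 1 (t * n) t = score n u \<eta> S t (fst (S t))"
        using expansion_eq_score[OF s(1) point] t by simp
      then have r: "\<eta> * (snd (S t) - u (snd s' 6 0)) = \<eta> * residual n u \<eta> S t"
        using s' by (simp add: residual_def)
      have eq: "fst s' 0 = n" "fst s' 1 = m" "fst s' 5 = t" "snd s' 9 = snd s 9" "snd s' 1 = snd s 1"
        "snd s' 2 = snd s 2" "snd s' 5 = snd s 5"
        using s' s by (auto simp: same_outside_def trained_def)
      show "runs u (Store 5 (IReg 5) (RMul (Cell 9 (ICon 0)) (RSub (Cell 2 (IReg 5)) (Act (Cell 6 (ICon 0)))))) s' 11
        (\<lambda>s'. fst s' 5 = t \<and> I (Suc t) ((fst s')(5 := Suc t), snd s'))"
        by (rule runs_mono[OF runs_Store[where Q = "\<lambda>s'. fst s' 5 = t \<and> I (Suc t) ((fst s')(5 := Suc t), snd s')"]])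
           (use s(1) t(1) r in \<open>auto simp: eq I_def trained_def less_Suc_eq simp del: One_nat_def\<close>)
    qed
    from runs_Seq[OF this]
    show "runs u body s T (\<lambda>s'. fst s' 5 = t \<and> I (Suc t) ((fst s')(5 := Suc t), snd s'))"
      unfolding body_def by (rule runs_mono) (auto simp: T_def)
  qed
  have div_mod: "(i * n + j) div n = i" "(i * n + j) mod n = j" "i * n + j < m * n" if "i < m" "j < n" for i j
  proof -
    have "i * n + j < Suc i * n" using that by simp
    also have "\<dots> \<le> m * n" using that by (intro mult_right_mono) auto
    finally show "i * n + j < m * n" .
  qed (use that in auto)
  have "runs u rate_prog s0 (16 * rounds (snd s0 0 2) + 35) (\<lambda>s'. same_outside {6} {9, 10} s0 s' \<and>
    snd s' 9 0 = rate (fst s0 2) (snd s0 0 0) (snd s0 0 1) (snd s0 0 2))"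
    by (rule runs_rate_prog) (use \<delta> in \<open>simp_all add: s0_def input_state_def\<close>)
  then have "runs u rate_prog s0 (16 * m + 35)
    (\<lambda>s'. runs u (For 5 (IReg 1) body) s' (m * (icost (IReg 1) + T + 6) + icost (IReg 1) + 4) (I m))"
  proof (rule runs_mono)
    fix s' assume s': "same_outside {6} {9, 10} s0 s' \<and>
      snd s' 9 0 = rate (fst s0 2) (snd s0 0 0) (snd s0 0 1) (snd s0 0 2)"
    have "trained n m u \<eta> S 0 s'"
      using s' div_mod by (auto simp: trained_def same_outside_def s0_def input_state_def \<eta>_def)
    then show "runs u (For 5 (IReg 1) body) s' (m * (icost (IReg 1) + T + 6) + icost (IReg 1) + 4) (I m)"
      by (rule For)
  qed (use rounds in \<open>simp add: s0_def input_state_def\<close>)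
  from runs_Seq[OF this] show ?thesis
    unfolding learner_prog_def body_def[symmetric] s0_def[symmetric]
    by (rule runs_mono) (auto simp: T_def I_def \<eta>_def algebra_simps)
qed

lemma runs_evaluator_prog:
  assumes s: "trained n m u \<eta> S m s"
  shows "runs u evaluator_prog (query_state n x s) (m * (25 * n + 40) + 20)
    (\<lambda>s'. answer s' = hypothesis n u \<eta> m S x)"
proof -
  define q where "q = query_state n x s"
  have q: "trained n m u \<eta> S m q" "fst q 0 = n" "fst q 1 = m"
    using s by (auto simp: q_def query_state_def trained_def)
  have point: "snd q 3 (0 + j) = x j" if "j < n" for j
    using that by (simp add: q_def query_state_def)
  have "runs u (score_prog 3 (ICon 0) (IReg 1)) q (m * (25 * fst q 0 + 40) + 13)
      (\<lambda>s'. same_outside {3, 4} {4, 6, 8} q s' \<and> snd s' 6 0 = expansion q 3 0 m \<and>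
        snd s' 4 0 = (\<Sum>i<m. u (expansion q 3 0 i)))"
    by (rule runs_score_prog) (use q in \<open>auto simp: same_outside_def\<close>)
  then have "runs u (score_prog 3 (ICon 0) (IReg 1)) q (m * (25 * n + 40) + 13)
      (\<lambda>s'. runs u (Store 4 (ICon 0) (RDiv (Cell 4 (ICon 0)) (OfNat (IReg 1)))) s' 7
        (\<lambda>s'. answer s' = hypothesis n u \<eta> m S x))"
  proof (rule runs_mono)
    fix s' assume s': "same_outside {3, 4} {4, 6, 8} q s' \<and> snd s' 6 0 = expansion q 3 0 m \<and>
        snd s' 4 0 = (\<Sum>i<m. u (expansion q 3 0 i))"
    have "(\<Sum>i<m. u (expansion q 3 0 i)) = (\<Sum>i<m. u (score n u \<eta> S i x))"
      by (intro sum.cong refl arg_cong[where f = u] expansion_eq_score[OF q(1) point]) auto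
    moreover have "fst s' 1 = m" using s' q by (simp add: same_outside_def)
    ultimately show "runs u (Store 4 (ICon 0) (RDiv (Cell 4 (ICon 0)) (OfNat (IReg 1)))) s' 7
        (\<lambda>s'. answer s' = hypothesis n u \<eta> m S x)"
      using s'
      by (intro runs_mono[OF runs_Store[where Q = "\<lambda>s'. answer s' = hypothesis n u \<eta> m S x"]])
         (simp_all add: answer_def hypothesis_def)
  qed (simp add: q)
  from runs_Seq[OF this] show ?thesis
    unfolding evaluator_prog_def q_def[symmetric] by (rule runs_mono) auto
qed

text \<open>Every monomial of the running times is at most \<open>(n + m) ^ 3\<close>, and the
  coefficients of the longer one sum to 152.\<close>

lemma learner_outputs_hypothesis:
  assumes \<delta>: "\<delta> > 0" and rounds: "rounds \<delta> \<le> m" and n: "n \<ge> 1"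
  shows "outputs_hypothesis u learner_prog evaluator_prog n (200 * (n + m) ^ 3)
    (input_state n m k L \<epsilon> \<delta> S) (hypothesis n u (rate k L \<epsilon> \<delta>) m S)"
proof -
  have cube: "m * (m * n) \<le> (n + m) ^ 3" "m * m \<le> (n + m) ^ 3" "m * n \<le> (n + m) ^ 3"
    "m \<le> (n + m) ^ 3" "1 \<le> (n + m) ^ 3"
  proof -
    have "a * (b * c) \<le> (n + m) ^ 3" if "a \<le> n + m" "b \<le> n + m" "c \<le> n + m" for a b c
      unfolding power3_eq_cube mult.assoc using that by (intro mult_mono) auto
    from this[of m m n] this[of m m 1] this[of m n 1] this[of m 1 1] this[of 1 1 1]
    show "m * (m * n) \<le> (n + m) ^ 3" "m * m \<le> (n + m) ^ 3" "m * n \<le> (n + m) ^ 3"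
      "m \<le> (n + m) ^ 3" "1 \<le> (n + m) ^ 3" using n by auto
  qed
  have "m * (m * (25 * n + 40) + 47) + 40 = 25 * (m * (m * n)) + 40 * (m * m) + 47 * m + 40"
    by (simp add: algebra_simps)
  with cube have T1: "m * (m * (25 * n + 40) + 47) + 40 \<le> 200 * (n + m) ^ 3" by linarith
  have "m * (25 * n + 40) + 20 = 25 * (m * n) + 40 * m + 20"
    by (simp add: algebra_simps)
  with cube have T2: "m * (25 * n + 40) + 20 \<le> 200 * (n + m) ^ 3" by linarith
  from runs_learner_prog[OF \<delta> rounds] obtain t s where
    "exec u learner_prog (input_state n m k L \<epsilon> \<delta> S) t s" "t \<le> m * (m * (25 * n + 40) + 47) + 40"
    and s: "trained n m u (rate k L \<epsilon> \<delta>) S m s"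
    unfolding runs_def by blast
  moreover have "\<exists>t' s'. exec u evaluator_prog (query_state n x s) t' s' \<and> t' \<le> 200 * (n + m) ^ 3 \<and>
      answer s' = hypothesis n u (rate k L \<epsilon> \<delta>) m S x" for x
    using runs_evaluator_prog[OF s, of x] T2 unfolding runs_def by (meson order_trans)
  ultimately show ?thesis
    unfolding outputs_hypothesis_def using T1 by (meson order_trans)
qed

section \<open>Choice of the parameters\<close>

lemma rounds_bounds:
  shows "1 \<le> real (rounds \<delta>)" "ln (1 / \<delta>) \<le> real (rounds \<delta>)"
    "real (rounds \<delta>) \<le> 2 * max 1 (log 2 (1 / \<delta>))"
proof -
  define l where "l = log 2 (1 / \<delta>)"
  show 1: "1 \<le> real (rounds \<delta>)" by (simp add: rounds_def)
  have l: "l \<le> real (rounds \<delta>)"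
    unfolding rounds_def l_def[symmetric] by linarith
  show "ln (1 / \<delta>) \<le> real (rounds \<delta>)"
  proof (cases "ln (1 / \<delta>) \<le> 0")
    case False
    then have "ln (1 / \<delta>) * ln 2 \<le> ln (1 / \<delta>) * 1"
      using ln_le_minus_one[of 2] by (intro mult_left_mono) auto
    then have "ln (1 / \<delta>) \<le> l"
      by (simp add: l_def log_def field_simps)
    with l show ?thesis by simp
  qed (use 1 in simp)
  show "real (rounds \<delta>) \<le> 2 * max 1 (log 2 (1 / \<delta>))"
    unfolding rounds_def l_def[symmetric] by linarith
qed

lemma rounds_le_sample_size:
  assumes "\<delta> > 0" "0 \<le> X" "real m \<ge> 2 powr X * max 1 (log 2 (1 / \<delta>))"
  shows "rounds \<delta> \<le> m"
proof -
  have "1 * max 1 (log 2 (1 / \<delta>)) \<le> 2 powr X * max 1 (log 2 (1 / \<delta>))"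
    using assms by (intro mult_right_mono ge_one_powr_ge_zero) auto
  with assms have "max 1 (log 2 (1 / \<delta>)) \<le> real m" by simp
  then show ?thesis unfolding rounds_def by (auto simp: nat_le_iff ceiling_le_iff)
qed

text \<open>The left-hand side is the sample size needed per unit of
  \<open>max 1 (log 2 (1 / \<delta>))\<close>; \<open>exp (32 * X)\<close> is
  \<open>exp (4 * R)\<close> for \<open>R = 8 * X\<close>. For \<open>X \<ge> 1\<close> constant and
  square are absorbed, giving \<open>exp (41 * X)\<close>, and
  \<open>41 \<le> 100 * ln 2\<close>.\<close>

lemma exp_growth:
  fixes X :: real
  assumes "X \<ge> 1"
  shows "128 * X\<^sup>2 * exp (32 * X) \<le> 2 powr (100 * X)"
proof -
  have "X \<le> exp X" using exp_ge_add_one_self[of X] by linarith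
  then have "X * X \<le> exp X * exp X" using assms by (intro mult_mono) auto
  then have X2: "X\<^sup>2 \<le> exp (2 * X)" by (simp add: power2_eq_square mult_exp_exp)
  have "(128::real) = 2 ^ 7" by simp
  also have "\<dots> \<le> exp 1 ^ 7" using exp_ge_add_one_self[of 1] by (intro power_mono) auto
  also have "\<dots> = exp 7" by (simp add: exp_of_nat_mult[symmetric])
  also have "\<dots> \<le> exp (7 * X)" using assms by simp
  finally have "128 * X\<^sup>2 * exp (32 * X) \<le> exp (7 * X) * exp (2 * X) * exp (32 * X)"
    using X2 by (intro mult_mono) auto
  also have "\<dots> = exp (41 * X)" by (simp add: mult_exp_exp)
  also have "\<dots> \<le> exp (100 * X * ln 2)"
  proof -
    have "X * 1 \<le> X * (2 * ln 2)"
      using assms ln2_ge_two_thirds by (intro mult_left_mono) auto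
    then show ?thesis using assms by simp
  qed
  finally show ?thesis by (simp add: powr_def)
qed

section \<open>The network: measurability and distance from a constant\<close>

lemma network2_eq: "network2 n k u a b x = u (\<Sum>i<k. b i * relu (ip n (a i) x))"
  by (simp add: network2_def ip_def)

lemma preactivation_measurable:
  fixes b :: "nat \<Rightarrow> real" and f :: "real \<Rightarrow> real"
  assumes "\<forall>i<k. a i \<in> unit_sphere n" "f \<in> borel_measurable borel"
  shows "(\<lambda>x. \<Sum>i<k. b i * f (ip n (a i) x)) \<in> borel_measurable (borel_vec n)"
proof -
  have a: "a i \<in> space (borel_vec n)" if "i < k" for i
    using assms(1) that unit_sphere_sets[of n, THEN sets.sets_into_space] by auto
  have "(\<lambda>x. b i * f (ip n (a i) x)) \<in> borel_measurable (borel_vec n)" if "i < k" for i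
  proof -
    have "(\<lambda>x. ip n (a i) x) \<in> borel_measurable (borel_vec n)"
      by (rule measurable_ip) (use a[OF that] in auto)
    from measurable_compose[OF this assms(2)] show ?thesis
      by (rule borel_measurable_times[OF borel_measurable_const])
  qed
  then show ?thesis by (auto intro!: borel_measurable_sum)
qed

lemma relu_measurable: "relu \<in> borel_measurable borel"
  unfolding relu_def by measurable

lemma hypothesis_rate_0: "m > 0 \<Longrightarrow> hypothesis n u 0 m S x = u 0"
  by (simp add: hypothesis_def score_eq_sum)

text \<open>The inner layer has absolute value at most \<open>k\<close> on the sphere, so the
  outputs differ by at most \<open>k * L \<le> \<epsilon>\<close>. They also differ by at most 1,
  whence even the square of the difference is at most \<open>\<epsilon>\<close>.\<close>

lemma network2_near_const:
  assumes "L-lipschitz_on UNIV u" "range u \<subseteq> {0..1}" "\<forall>i<k. a i \<in> unit_sphere n"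
    "b \<in> unit_sphere k" "x \<in> unit_sphere n" "real k * L \<le> \<epsilon>"
  shows "(u 0 - network2 n k u a b x)\<^sup>2 \<le> \<epsilon>"
proof -
  define g where "g = (\<Sum>i<k. b i * relu (ip n (a i) x))"
  have L: "L \<ge> 0" using assms(1) by (rule lipschitz_on_nonneg)
  have "\<bar>g\<bar> \<le> (\<Sum>i<k. 1)"
    unfolding g_def
  proof (rule sum_abs[THEN order_trans], rule sum_mono)
    fix i assume "i \<in> {..<k}"
    then have "\<bar>b i\<bar> \<le> 1" "\<bar>ip n (a i) x\<bar> \<le> 1"
      using assms abs_le_1_on_sphere abs_ip_le_1 by auto
    then have "\<bar>b i\<bar> * \<bar>relu (ip n (a i) x)\<bar> \<le> 1 * 1"
      by (intro mult_mono) (auto simp: relu_def)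
    then show "\<bar>b i * relu (ip n (a i) x)\<bar> \<le> 1" by (simp add: abs_mult)
  qed
  then have "L * \<bar>g\<bar> \<le> L * real k" using L by (intro mult_left_mono) auto
  then have 1: "\<bar>u 0 - u g\<bar> \<le> \<epsilon>"
    using lipschitz_onD[OF assms(1), of 0 g] assms(6) by (simp add: dist_real_def mult.commute)
  have "u 0 \<in> {0..1}" "u g \<in> {0..1}" using assms(2) by blast+
  then have "\<bar>u 0 - u g\<bar> \<le> 1" by auto
  with 1 have "\<bar>u 0 - u g\<bar> * \<bar>u 0 - u g\<bar> \<le> \<epsilon> * 1" by (intro mult_mono) auto
  then show ?thesis by (simp add: network2_eq g_def power2_eq_square abs_mult[symmetric])
qed

text \<open>The error budget is \<open>\<epsilon> / 4\<close> for the approximation of ReLU,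
  \<open>\<epsilon> / 8\<close> for the step size, \<open>\<epsilon> / 4\<close> for the initial
  potential and \<open>\<epsilon> / 4\<close> for the deviation. The assumption \<open>large\<close>
  gives \<open>X \<ge> 1\<close>, so that \<open>R = 8 * X\<close> is admissible in
  \<open>relu_approx\<close> and \<open>exp_growth\<close> applies; it also forces
  \<open>L > 0\<close>.\<close>

lemma error_bound:
  fixes D :: "((nat \<Rightarrow> real) \<times> real) measure"
  assumes k: "k \<ge> 1" and \<epsilon>: "\<epsilon> > 0" and \<delta>: "\<delta> > 0" and m: "real m \<ge> 2 powr (100 * (real k * L / \<epsilon>)) * max 1 (log 2 (1 / \<delta>))"
    and u: "range u \<subseteq> {0..1}" "L-lipschitz_on UNIV u" "mono u"
    and a: "\<forall>i<k. a i \<in> unit_sphere n" and b: "b \<in> unit_sphere k"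
    and D: "distribution_on_sphere n D"
    and label: "AE z in D. label_given_point n D z = network2 n k u a b (fst z)"
    and large: "\<epsilon> < real k * L"
  shows "measure (Pi\<^sub>M {..<m} (\<lambda>_. D)) {S \<in> space (Pi\<^sub>M {..<m} (\<lambda>_. D)).
      integrable D (\<lambda>(x, y). (hypothesis n u (rate k L \<epsilon> \<delta>) m S x - network2 n k u a b x)\<^sup>2) \<and>
      (\<integral>(x, y). (hypothesis n u (rate k L \<epsilon> \<delta>) m S x - network2 n k u a b x)\<^sup>2 \<partial>D) \<le> \<epsilon>} \<ge> 1 - \<delta>"
proof -
  define X where "X = real k * L / \<epsilon>"
  define \<Lambda> where "\<Lambda> = real (rounds \<delta>)"
  define M where "M = max 1 (log 2 (1 / \<delta>))"
  define \<eta> where "\<eta> = \<epsilon> / (16 * L * \<Lambda>)"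
  have X: "X \<ge> 1" using large \<epsilon> by (simp add: X_def)
  have L: "L > 0" using large \<epsilon> k lipschitz_on_nonneg[OF u(2)] by (cases "L = 0") auto
  note \<Lambda> = rounds_bounds[of \<delta>, folded \<Lambda>_def M_def]
  have \<eta>: "\<eta> > 0" "rate k L \<epsilon> \<delta> = \<eta>"
    using \<epsilon> L \<Lambda>(1) large by (auto simp: \<eta>_def rate_def \<Lambda>_def)
  have R: "8 * X \<ge> 1" using X by simp
  obtain p f where f: "\<And>z. (\<lambda>j. p j * z ^ j) sums f z"
    and p: "\<And>j. \<bar>p j\<bar> \<le> (8 * X) ^ j / fact j" and fr: "\<And>z. \<bar>f z - relu z\<bar> \<le> 1 / (8 * X)"
    using relu_approx[OF R] by metis
  have b1: "\<bar>b i\<bar> \<le> 1" if "i < k" for i using b that by (rule abs_le_1_on_sphere)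
  define g where "g = (\<lambda>x. \<Sum>i<k. b i * relu (ip n (a i) x))"
  define v where "v = (\<lambda>x. \<Sum>i<k. b i * f (ip n (a i) x))"
  define V where "V = (real k)\<^sup>2 * exp (4 * (8 * X))"
  define \<xi> where "\<xi> = \<epsilon> / (8 * L)"
  have f_meas: "f \<in> borel_measurable borel"
  proof -
    have "f = (\<lambda>z. \<Sum>j. p j * z ^ j)" using f by (auto simp: sums_iff)
    then show ?thesis by simp
  qed
  have "v \<in> borel_measurable (borel_vec n)"
    unfolding v_def using a f_meas by (rule preactivation_measurable)
  moreover have "g \<in> borel_measurable (borel_vec n)"
    unfolding g_def using a relu_measurable by (rule preactivation_measurable)
  moreover have "\<bar>v x - g x\<bar> \<le> \<xi>" for x
  proof -
    have "\<bar>v x - g x\<bar> = \<bar>\<Sum>i<k. b i * (f (ip n (a i) x) - relu (ip n (a i) x))\<bar>"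
      by (simp add: v_def g_def sum_subtractf[symmetric] right_diff_distrib)
    also have "\<dots> \<le> (\<Sum>i<k. 1 * (1 / (8 * X)))"
    proof (rule sum_abs[THEN order_trans], rule sum_mono)
      fix i assume "i \<in> {..<k}"
      then show "\<bar>b i * (f (ip n (a i) x) - relu (ip n (a i) x))\<bar> \<le> 1 * (1 / (8 * X))"
        unfolding abs_mult by (intro mult_mono fr b1) auto
    qed
    also have "\<dots> = \<xi>" using k L \<epsilon> by (simp add: \<xi>_def X_def)
    finally show ?thesis .
  qed
  moreover have "rkhs_bound n v V"
    unfolding v_def V_def by (rule rkhs_bound_combination[OF f p]) (use R a b1 in auto)
  ultimately interpret glm_learning n u L \<eta> D g v V \<xi>
    by unfold_locales (use D u L \<eta> \<epsilon> label in \<open>auto simp: \<xi>_def network2_eq g_def\<close>)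
  have m0: "m > 0"
  proof -
    have "0 < 2 powr (100 * X) * M" by (simp add: M_def)
    with m show ?thesis unfolding X_def[symmetric] M_def[symmetric] by (metis less_le_trans of_nat_0_less_iff)
  qed
  have "L * V / (\<eta> * real m) \<le> \<epsilon> / 4"
  proof -
    \<comment> \<open>With \<open>\<eta>\<close> proportional to \<open>\<epsilon> / L\<close>, the
      factors \<open>k\<^sup>2\<close>, \<open>L\<^sup>2\<close> and
      \<open>1 / \<epsilon>\<^sup>2\<close> combine to \<open>X\<^sup>2\<close>, so apart from
      \<open>\<delta>\<close> the sample size depends on \<open>X\<close> alone.\<close>
    have "L * V / \<eta> = \<epsilon> * (16 * X\<^sup>2 * exp (32 * X)) * \<Lambda>"
      using L \<epsilon> \<Lambda>(1) by (simp add: V_def \<eta>_def X_def field_simps power2_eq_square)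
    also have "\<dots> \<le> \<epsilon> * (16 * X\<^sup>2 * exp (32 * X)) * (2 * M)"
      using \<epsilon> by (intro mult_left_mono \<Lambda>) auto
    also have "\<dots> = \<epsilon> / 4 * (128 * X\<^sup>2 * exp (32 * X) * M)" by simp
    also have "\<dots> \<le> \<epsilon> / 4 * (2 powr (100 * X) * M)"
      using \<epsilon> exp_growth[OF X] by (intro mult_left_mono mult_right_mono) (auto simp: M_def)
    also have "\<dots> \<le> \<epsilon> / 4 * real m"
      using \<epsilon> m by (intro mult_left_mono) (auto simp: X_def M_def)
    finally show ?thesis
      using m0 by (simp add: divide_le_eq flip: divide_divide_eq_left)
  qed
  moreover have "2 * L * (\<eta> + \<xi>) \<le> \<epsilon> / 8 + \<epsilon> / 4"
  proof -
    have "2 * L * \<eta> = \<epsilon> / 8 / \<Lambda>" using L by (simp add: \<eta>_def)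
    also have "\<dots> \<le> \<epsilon> / 8 / 1" using \<epsilon> \<Lambda>(1) by (intro divide_left_mono) auto
    finally show ?thesis using L by (simp add: \<xi>_def distrib_left)
  qed
  moreover have "4 * \<eta> * L * ln (1 / \<delta>) \<le> \<epsilon> / 4"
  proof -
    have "4 * \<eta> * L * ln (1 / \<delta>) \<le> 4 * \<eta> * L * \<Lambda>"
      using \<eta> L \<Lambda>(2) by (intro mult_left_mono) auto
    also have "\<dots> = \<epsilon> / 4" using L \<Lambda>(1) by (simp add: \<eta>_def)
    finally show ?thesis .
  qed
  ultimately have total: "2 * L * (\<eta> + \<xi>) + L * V / (\<eta> * real m) + 4 * \<eta> * L * ln (1 / \<delta>) \<le> \<epsilon>"
    using \<epsilon> by linarith
  interpret S: prob_space "sample_measure m"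
    by (intro prob_space_PiM) unfold_locales
  have "1 - \<delta> \<le> measure (sample_measure m) {S \<in> space (sample_measure m). (\<Sum>t<m. err S t) / real m
      \<le> 2 * L * (\<eta> + \<xi>) + L * V / (\<eta> * real m) + 4 * \<eta> * L * ln (1 / \<delta>)}"
    by (rule average_error_bound[OF m0 \<delta>])
  also have "\<dots> \<le> measure (sample_measure m) {S \<in> space (sample_measure m). sq_error (hypothesis n u \<eta> m S) \<le> \<epsilon>}"
    using hypothesis_error_le[OF _ m0] total
    by (intro S.finite_measure_mono) (auto intro: order_trans)
  also have "{S \<in> space (sample_measure m). sq_error (hypothesis n u \<eta> m S) \<le> \<epsilon>}
    = {S \<in> space (sample_measure m).
      integrable D (\<lambda>(x, y). (hypothesis n u \<eta> m S x - network2 n k u a b x)\<^sup>2) \<and>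
      (\<integral>(x, y). (hypothesis n u \<eta> m S x - network2 n k u a b x)\<^sup>2 \<partial>D) \<le> \<epsilon>}"
  proof -
    have split: "(\<lambda>(x, y :: real). (hypothesis n u \<eta> m S x - network2 n k u a b x)\<^sup>2)
        = (\<lambda>z. (hypothesis n u \<eta> m S (fst z) - u (g (fst z)))\<^sup>2)" for S
      by (auto simp: fun_eq_iff network2_eq g_def)
    show ?thesis
      unfolding split using hypothesis_integrable by (auto simp: sq_error_def)
  qed
  finally show ?thesis by (simp add: \<eta>(2))
qed

text \<open>With rate 0 every sample yields the constant \<open>u 0\<close>, so the event is the
  whole sample space.\<close>

lemma error_bound_near_const:
  fixes D :: "((nat \<Rightarrow> real) \<times> real) measure"
  assumes m: "m > 0" and \<delta>: "\<delta> > 0"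
    and u: "range u \<subseteq> {0..1}" "L-lipschitz_on UNIV u" "mono u"
    and a: "\<forall>i<k. a i \<in> unit_sphere n" and b: "b \<in> unit_sphere k"
    and D: "distribution_on_sphere n D"
    and small: "real k * L \<le> \<epsilon>"
  shows "measure (Pi\<^sub>M {..<m} (\<lambda>_. D)) {S \<in> space (Pi\<^sub>M {..<m} (\<lambda>_. D)).
      integrable D (\<lambda>(x, y). (hypothesis n u (rate k L \<epsilon> \<delta>) m S x - network2 n k u a b x)\<^sup>2) \<and>
      (\<integral>(x, y). (hypothesis n u (rate k L \<epsilon> \<delta>) m S x - network2 n k u a b x)\<^sup>2 \<partial>D) \<le> \<epsilon>} \<ge> 1 - \<delta>"
proof -
  interpret prob_space D using D by (simp add: distribution_on_sphere_def)
  interpret S: prob_space "Pi\<^sub>M {..<m} (\<lambda>_. D)"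
    by (intro prob_space_PiM) unfold_locales
  define F where "F = (\<lambda>z :: (nat \<Rightarrow> real) \<times> real. (u 0 - network2 n k u a b (fst z))\<^sup>2)"
  have F: "(\<lambda>(x, y). (hypothesis n u (rate k L \<epsilon> \<delta>) m S x - network2 n k u a b x)\<^sup>2) = F" for S
    using small m by (auto simp: F_def rate_def hypothesis_rate_0)
  note [measurable] = fst_measurable_distribution[OF D] borel_measurable_mono[OF u(3)]
    preactivation_measurable[OF a relu_measurable]
  have [measurable]: "F \<in> borel_measurable D"
    unfolding F_def network2_eq by measurable
  have le: "F z \<le> \<epsilon>" "0 \<le> F z" if "z \<in> space D" for z
    using network2_near_const[OF u(2,1) a b _ small] that
    by (auto simp: F_def space_distribution[OF D])
  have "integrable D F"
    by (rule integrable_const_bound[of _ \<epsilon>]) (use le in \<open>auto intro!: AE_I2\<close>)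
  moreover from this have "expectation F \<le> \<epsilon>"
    by (rule integral_le_const) (use le in \<open>auto intro!: AE_I2\<close>)
  ultimately show ?thesis
    using \<delta> S.prob_space by (simp add: F)
qed

theorem theorem5:
  "\<exists>(C::real) (c::nat) (d::nat) (learner::com) (evaluator::com). C > 0 \<and>
    (\<forall>(n::nat) (k::nat) (m::nat) (L::real) (\<epsilon>::real) (\<delta>::real) (\<sigma>' :: real \<Rightarrow> real)
       (a :: nat \<Rightarrow> nat \<Rightarrow> real) (b :: nat \<Rightarrow> real) (D :: ((nat \<Rightarrow> real) \<times> real) measure).
       n \<ge> 1 \<longrightarrow> k \<ge> 1 \<longrightarrow> \<epsilon> > 0 \<longrightarrow> 0 < \<delta> \<longrightarrow> \<delta> < 1 \<longrightarrow>
       range \<sigma>' \<subseteq> {0..1} \<longrightarrow> L-lipschitz_on UNIV \<sigma>' \<longrightarrow> mono \<sigma>' \<longrightarrow>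
       (\<forall>i<k. a i \<in> unit_sphere n) \<longrightarrow> b \<in> unit_sphere k \<longrightarrow>
       distribution_on_sphere n D \<longrightarrow>
       (AE z in D. label_given_point n D z = network2 n k \<sigma>' a b (fst z)) \<longrightarrow>
       real m \<ge> 2 powr (C * (real k * L / \<epsilon>)) * max 1 (log 2 (1 / \<delta>)) \<longrightarrow>
       (\<exists>h :: (nat \<Rightarrow> (nat \<Rightarrow> real) \<times> real) \<Rightarrow> (nat \<Rightarrow> real) \<Rightarrow> real.
          (\<forall>S \<in> space (Pi\<^sub>M {..<m} (\<lambda>_. D)).
             outputs_hypothesis \<sigma>' learner evaluator n (c * (n + m) ^ d)
               (input_state n m k L \<epsilon> \<delta> S) (h S)) \<and>
          measure (Pi\<^sub>M {..<m} (\<lambda>_. D))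
            {S \<in> space (Pi\<^sub>M {..<m} (\<lambda>_. D)).
               integrable D (\<lambda>(x, y). (h S x - network2 n k \<sigma>' a b x)\<^sup>2) \<and>
               (\<integral>(x, y). (h S x - network2 n k \<sigma>' a b x)\<^sup>2 \<partial>D) \<le> \<epsilon>} \<ge> 1 - \<delta>))"
\<comment> \<open>The constant 100 comes from \<open>exp_growth\<close>. The degree 3 reflects of
  the order of \<open>m\<^sup>2\<close> kernel evaluations, each of which takes time linear in
  \<open>n\<close>.\<close>
proof (rule exI[of _ 100], rule exI[of _ 200], rule exI[of _ 3], rule exI[of _ learner_prog],
    rule exI[of _ evaluator_prog], intro conjI allI impI)
  fix n k m :: nat and L \<epsilon> \<delta> :: real and \<sigma>' :: "real \<Rightarrow> real" and a :: "nat \<Rightarrow> nat \<Rightarrow> real"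
    and b :: "nat \<Rightarrow> real" and D :: "((nat \<Rightarrow> real) \<times> real) measure"
  assume n: "n \<ge> 1" and k: "k \<ge> 1" and \<epsilon>: "\<epsilon> > 0" and \<delta>: "0 < \<delta>" "\<delta> < 1"
    and u: "range \<sigma>' \<subseteq> {0..1}" "L-lipschitz_on UNIV \<sigma>'" "mono \<sigma>'"
    and a: "\<forall>i<k. a i \<in> unit_sphere n" and b: "b \<in> unit_sphere k" and D: "distribution_on_sphere n D"
    and label: "AE z in D. label_given_point n D z = network2 n k \<sigma>' a b (fst z)"
    and m: "real m \<ge> 2 powr (100 * (real k * L / \<epsilon>)) * max 1 (log 2 (1 / \<delta>))"
  have "0 \<le> 100 * (real k * L / \<epsilon>)"
    using \<epsilon> lipschitz_on_nonneg[OF u(2)] by simp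
  then have rounds: "rounds \<delta> \<le> m"
    by (rule rounds_le_sample_size[OF \<delta>(1) _ m])
  then have m0: "m > 0" by (simp add: rounds_def)
  show "\<exists>h. (\<forall>S\<in>space (Pi\<^sub>M {..<m} (\<lambda>_. D)).
       outputs_hypothesis \<sigma>' learner_prog evaluator_prog n (200 * (n + m) ^ 3)
         (input_state n m k L \<epsilon> \<delta> S) (h S)) \<and>
     1 - \<delta> \<le> measure (Pi\<^sub>M {..<m} (\<lambda>_. D)) {S \<in> space (Pi\<^sub>M {..<m} (\<lambda>_. D)).
       integrable D (\<lambda>(x, y). (h S x - network2 n k \<sigma>' a b x)\<^sup>2) \<and>
       (\<integral>(x, y). (h S x - network2 n k \<sigma>' a b x)\<^sup>2 \<partial>D) \<le> \<epsilon>}"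
  proof (intro exI[of _ "hypothesis n \<sigma>' (rate k L \<epsilon> \<delta>) m"] conjI ballI)
    show "outputs_hypothesis \<sigma>' learner_prog evaluator_prog n (200 * (n + m) ^ 3)
       (input_state n m k L \<epsilon> \<delta> S) (hypothesis n \<sigma>' (rate k L \<epsilon> \<delta>) m S)" for S
      by (rule learner_outputs_hypothesis[OF \<delta>(1) rounds n])
    show "1 - \<delta> \<le> measure (Pi\<^sub>M {..<m} (\<lambda>_. D)) {S \<in> space (Pi\<^sub>M {..<m} (\<lambda>_. D)).
       integrable D (\<lambda>(x, y). (hypothesis n \<sigma>' (rate k L \<epsilon> \<delta>) m S x - network2 n k \<sigma>' a b x)\<^sup>2) \<and>
       (\<integral>(x, y). (hypothesis n \<sigma>' (rate k L \<epsilon> \<delta>) m S x - network2 n k \<sigma>' a b x)\<^sup>2 \<partial>D) \<le> \<epsilon>}"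
    proof (cases "\<epsilon> < real k * L")
      case True
      then show ?thesis
        by (rule error_bound[OF k \<epsilon> \<delta>(1) m u a b D label])
    next
      case False
      then show ?thesis
        by (intro error_bound_near_const[OF m0 \<delta>(1) u a b D]) simp
    qed
  qed
qed simp

end
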